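(* Let $\{y(u,\cdot)\mid u\in\mathbb{R}\}$ be an Arratia flow, and for $t\in(0,1]$ let $$\nu(t)=\lambda\{u\in\mathbb{R}\mid y(0,t)=y(u,t)\},$$ where $\lambda$ is the Lebesgue measure on the real line. Then, almost surely, $$\limsup_{t\to 0+}\frac{\nu(t)}{\sqrt{2t\ln\ln t^{-1}}}\ \geq\ 1$$ and $$\limsup_{t\to 0+}\frac{\nu(t)}{2\sqrt{t\ln\ln t^{-1}}}\ \leq\ 1.$$
   Context: Definition (Arratia flow). A family of random processes $\{y(u,\cdot)\mid u\in\mathbb{R}\}$ on a common probability space, with $y(u)\equiv\{y(u,t)\mid t\in\mathbb{R}^+\}$, is called the Arratia flow if: 1) for any $u\in\mathbb{R}$, $y(u)$ is a Wiener process with $y(u,0)=u$ (i.e. a standard Brownian motion started from $u$); 2) for $u_1\le u_2$, $y(u_1)\le y(u_2)$ (i.e. $y(u_1,t)\le y(u_2,t)$ for all $t\ge 0$); 3) for all $u_1,u_2$, the joint characteristic (quadratic covariation) at time $t$ of the martingale parts of $y(u_1)$ and $y(u_2)$, these processes being considered with respect to the joint filtration generated by the whole family $\{y(u)\mid u\in\mathbb{R}\}$, equals $\int_0^t \mathbf{1}_{\{y(u_1,s)=y(u_2,s)\}}\,ds$ for all $t\ge 0$. Informally, this is a system of coalescing Wiener processes started from all points of the real line, which are independent before they meet and move together after meeting. Standing convention: the version of the flow is chosen such that the mapping $u\mapsto\{y(u,t)\mid t\in[0,1]\}$ is right continuous as a mapping from $\mathbb{R}$ to $C([0,1])$ with the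 uniform norm (such a version is known to exist). The set $\{u\mid y(0,t)=y(u,t)\}$ is the cluster of all particles that have coalesced with the particle started from $0$ by time $t$, and $\nu(t)$ is its size. The iterated logarithm $\ln\ln t^{-1}$ is considered for small $t>0$, where it is positive. *)

theory Defs
  imports "HOL-Probability.Probability"
begin

text \<open>Stochastic processes are functions \<open>X t \<omega>\<close> of a real time parameter; only the
  values at times \<open>t \<ge> 0\<close> are ever constrained or used.\<close>

definition wiener_process :: "'a measure \<Rightarrow> real \<Rightarrow> (real \<Rightarrow> 'a \<Rightarrow> real) \<Rightarrow> bool" where
  "wiener_process M u X \<longleftrightarrow>
     (\<forall>t\<ge>0. X t \<in> borel_measurable M) \<and>
     (\<forall>\<omega>\<in>space M. X 0 \<omega> = u) \<and>
     (\<forall>\<omega>\<in>space M. continuous_on {0..} (\<lambda>t. X t \<omega>)) \<and>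
     (\<forall>s t. 0 \<le> s \<longrightarrow> s < t \<longrightarrow>
        distributed M lborel (\<lambda>\<omega>. X t \<omega> - X s \<omega>) (normal_density 0 (sqrt (t - s)))) \<and>
     (\<forall>(\<tau> :: nat \<Rightarrow> real) n. 0 \<le> \<tau> 0 \<longrightarrow> mono \<tau> \<longrightarrow>
        prob_space.indep_vars M (\<lambda>_. borel) (\<lambda>i \<omega>. X (\<tau> (Suc i)) \<omega> - X (\<tau> i) \<omega>) {..<n})"

definition joint_filtration ::
    "'a measure \<Rightarrow> ('i \<Rightarrow> real \<Rightarrow> 'a \<Rightarrow> real) \<Rightarrow> real \<Rightarrow> 'a measure" where
  "joint_filtration M y t =
     sigma (space M) {y u s -` B \<inter> space M | u s B. 0 \<le> s \<and> s \<le> t \<and> B \<in> sets borel}"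

definition is_martingale ::
    "'a measure \<Rightarrow> (real \<Rightarrow> 'a measure) \<Rightarrow> (real \<Rightarrow> 'a \<Rightarrow> real) \<Rightarrow> bool" where
  "is_martingale M F X \<longleftrightarrow>
     (\<forall>t\<ge>0. X t \<in> borel_measurable (F t) \<and> integrable M (X t)) \<and>
     (\<forall>s t. 0 \<le> s \<longrightarrow> s \<le> t \<longrightarrow> (AE \<omega> in M. real_cond_exp M (F s) (X t) \<omega> = X s \<omega>))"

definition square_integrable_martingale ::
    "'a measure \<Rightarrow> (real \<Rightarrow> 'a measure) \<Rightarrow> (real \<Rightarrow> 'a \<Rightarrow> real) \<Rightarrow> bool" where
  "square_integrable_martingale M F X \<longleftrightarrow>
     is_martingale M F X \<and> (\<forall>t\<ge>0. integrable M (\<lambda>\<omega>. (X t \<omega>)\<^sup>2))"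

text \<open>The process \<open>A\<close> is the quadratic covariation of the square integrable martingales
  \<open>X\<close> and \<open>Y\<close>, both of which have continuous paths in the intended use: the adapted
  continuous process of locally bounded variation (a difference of nondecreasing functions,
  pathwise) that starts at \<open>0\<close> and compensates the product \<open>X Y\<close>. These properties
  determine \<open>A\<close> up to indistinguishability.\<close>

definition is_quadratic_covariation ::
    "'a measure \<Rightarrow> (real \<Rightarrow> 'a measure) \<Rightarrow> (real \<Rightarrow> 'a \<Rightarrow> real) \<Rightarrow> (real \<Rightarrow> 'a \<Rightarrow> real) \<Rightarrow>
      (real \<Rightarrow> 'a \<Rightarrow> real) \<Rightarrow> bool" where
  "is_quadratic_covariation M F X Y A \<longleftrightarrow>
     square_integrable_martingale M F X \<and> square_integrable_martingale M F Y \<and>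
     (\<forall>t\<ge>0. A t \<in> borel_measurable (F t)) \<and>
     (\<forall>\<omega>\<in>space M. A 0 \<omega> = 0 \<and> continuous_on {0..} (\<lambda>t. A t \<omega>) \<and>
        (\<exists>f g :: real \<Rightarrow> real. mono_on {0..} f \<and> mono_on {0..} g \<and> (\<forall>t\<ge>0. A t \<omega> = f t - g t))) \<and>
     is_martingale M F (\<lambda>t \<omega>. X t \<omega> * Y t \<omega> - A t \<omega>)"

text \<open>The martingale part of a Wiener process started at \<open>u\<close> is that process minus \<open>u\<close>.
  In particular, it is required to be a martingale for the joint filtration of the whole family.\<close>

definition arratia_flow :: "'a measure \<Rightarrow> (real \<Rightarrow> real \<Rightarrow> 'a \<Rightarrow> real) \<Rightarrow> bool" where
  "arratia_flow M y \<longleftrightarrow>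
     prob_space M \<and>
     (\<forall>u. wiener_process M u (y u)) \<and>
     (\<forall>u1 u2. u1 \<le> u2 \<longrightarrow> (AE \<omega> in M. \<forall>t\<ge>0. y u1 t \<omega> \<le> y u2 t \<omega>)) \<and>
     (\<forall>u1 u2. is_quadratic_covariation M (joint_filtration M y)
        (\<lambda>t \<omega>. y u1 t \<omega> - u1) (\<lambda>t \<omega>. y u2 t \<omega> - u2)
        (\<lambda>t \<omega>. LINT s:{0..t}|lborel. indicator {s. y u1 s \<omega> = y u2 s \<omega>} s))"

text \<open>Right continuity of \<open>u \<mapsto> y u\<close> as a map into \<open>C([0,1])\<close> with the
  uniform norm; the paths of an Arratia flow are continuous by definition.\<close>

definition right_continuous_version :: "'a measure \<Rightarrow> (real \<Rightarrow> real \<Rightarrow> 'a \<Rightarrow> real) \<Rightarrow> bool" where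
  "right_continuous_version M y \<longleftrightarrow>
     (AE \<omega> in M. \<forall>u. uniform_limit {0..1} (\<lambda>v t. y v t \<omega>) (\<lambda>t. y u t \<omega>) (at_right u))"

definition cluster_size :: "(real \<Rightarrow> real \<Rightarrow> 'a \<Rightarrow> real) \<Rightarrow> real \<Rightarrow> 'a \<Rightarrow> ennreal" where
  "cluster_size y t \<omega> = emeasure lebesgue {u. y 0 t \<omega> = y u t \<omega>}"

end

theory Submission
  imports Defs "HOL-Real_Asymp.Real_Asymp"
begin

text \<open>
  The gap \<open>Z = y u2 - y u1\<close> of two particles is a nonnegative continuous martingale with
  bracket \<open>2 \<integral> 1{Z s \<noteq> 0} ds\<close>, and it is absorbed at \<open>0\<close>. As \<open>sin\<close> vanishes at \<open>0\<close>,
  \<open>exp (l\<^sup>2 t) sin (l Z t)\<close> is a martingale for every \<open>l\<close>; integrating this against \<open>dl / l\<close> turns the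
  sine into a sign and gives the conditional law of coalescence exactly: given the past up to \<open>s\<close>,
  \<open>Z t > 0\<close> has probability \<open>E sgn (Z s + sqrt (2 (t - s)) N)\<close> with \<open>N\<close> standard normal.

  In particular particles at distance \<open>d\<close> have met by time \<open>t\<close> with probability at most
  \<open>2 exp (- d\<^sup>2 / (4 t))\<close>. A cluster larger than \<open>x\<close> contains two points of a fixed finite grid at
  distance almost \<open>x\<close>, so the upper bound follows from Borel--Cantelli along a geometric sequence of times.

  For the lower bound take the times \<open>exp (- k\<^sup>2)\<close> and the particles started from
  \<open>2 c sqrt (exp (- k\<^sup>2) ln k)\<close>. Before time \<open>exp (- (k + 1)\<^sup>2)\<close> such a particle hardly moves, so, conditionally
  on that past, it merges with the particle from \<open>0\<close> by time \<open>exp (- k\<^sup>2)\<close> with probability at least \<open>1 / k\<close>.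
\<close>

section \<open>Taylor and Euler estimates, and the sine transform\<close>

text \<open>Maclaurin's formula with remainder of order three, the factor 1/6 being rounded up to 1.
  Order three is right because the absolute third moment of a gap increment over a time step of
  length \<open>h\<close> is of order \<open>h * sqrt h\<close>, which is negligible when summed
  over a fine partition.\<close>

lemma sin_add_taylor2:
  fixes a h :: real
  shows "\<bar>sin (a + h) - (sin a + h * cos a - h\<^sup>2 / 2 * sin a)\<bar> \<le> \<bar>h\<bar> ^ 3"
proof -
  \<comment> \<open>Each derivative of sine is a quarter-turn shift, so one formula covers all
    orders.\<close>
  let ?diff = "\<lambda>n x. sin (a + x + 1/2 * real n * pi)"
  have "\<forall>m x. DERIV (?diff m) x :> ?diff (Suc m) x"
    by (auto intro!: derivative_eq_intros simp: sin_expansion_lemma algebra_simps sin_add cos_add distrib_right)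
      (simp_all add: sin_add cos_add algebra_simps add_divide_distrib)
  then obtain t where t: "sin (a + h) = (\<Sum>m<3. ?diff m 0 / fact m * h ^ m) + ?diff 3 t / fact 3 * h ^ 3"
    using Maclaurin_all_le[of ?diff "\<lambda>x. sin (a + x)" h 3] by auto
  have "(\<Sum>m<3. ?diff m 0 / fact m * h ^ m) = sin a + h * cos a - h\<^sup>2 / 2 * sin a"
    by (simp add: eval_nat_numeral sin_add cos_add algebra_simps)
  then have "\<bar>sin (a + h) - (sin a + h * cos a - h\<^sup>2 / 2 * sin a)\<bar> = \<bar>?diff 3 t\<bar> / 6 * \<bar>h\<bar>^3"
    using t by (simp add: abs_mult power_abs fact_numeral)
  also have "\<dots> \<le> 1 * \<bar>h\<bar>^3"
    using abs_sin_le_one[of "a + t + 3 * pi / 2"] by (intro mult_right_mono) (auto simp del: abs_sin_le_one)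
  finally show ?thesis by simp
qed

text \<open>Euler scheme for \<open>f' = - a * f\<close>: with \<open>n\<close> steps of length
  \<open>h = T / n\<close> the local errors add up to \<open>C * T * sqrt h\<close>, which tends to
  0, while \<open>(1 - a * T / n)^n\<close> tends to \<open>exp (- a * T)\<close>.\<close>

lemma exponential_decay_of_local_estimate:
  fixes f :: "real \<Rightarrow> real"
  assumes "s < t" "0 \<le> a" "0 \<le> C"
    and step: "\<And>r h. s \<le> r \<Longrightarrow> 0 < h \<Longrightarrow> r + h \<le> t \<Longrightarrow>
      \<bar>f (r + h) - (1 - a * h) * f r\<bar> \<le> C * (h * sqrt h)"
  shows "f t = exp (- a * (t - s)) * f s"
proof -
  define T where "T = t - s"
  have T: "T > 0" using assms by (simp add: T_def)
  \<comment> \<open>The condition \<open>a * T \<le> n\<close> keeps the factor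
    \<open>1 - a * h\<close> in [0, 1], so the errors of earlier steps are not amplified.\<close>
  have bound: "\<bar>f t - (1 - a * T / n)^n * f s\<bar> \<le> C * T * sqrt (T / n)"
    if n: "n > 0" "a * T \<le> n" for n :: nat
  proof -
    define h where "h = T / n"
    have h: "0 < h" "n * h = T" "a * h \<le> 1" "0 \<le> a * h"
      using n T \<open>0 \<le> a\<close> by (auto simp: h_def field_simps)
    have "\<bar>f (s + k * h) - (1 - a * h)^k * f s\<bar> \<le> k * (C * (h * sqrt h))" if "k \<le> n" for k
      using that
    proof (induction k)
      case (Suc k)
      have "real (Suc k) * h \<le> n * h" using Suc h by (intro mult_right_mono) auto
      then have "s + real (Suc k) * h \<le> t" using h by (simp add: T_def)
      then have le: "s + k * h + h \<le> t" by (simp add: algebra_simps)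
      have 1: "\<bar>f (s + k * h + h) - (1 - a * h) * f (s + k * h)\<bar> \<le> C * (h * sqrt h)"
        using h le by (intro step) auto
      have "\<bar>(1 - a * h) * (f (s + k * h) - (1 - a * h)^k * f s)\<bar> \<le> 1 * (k * (C * (h * sqrt h)))"
        unfolding abs_mult using Suc h by (intro mult_mono) auto
      then have "\<bar>f (s + k * h + h) - (1 - a * h) * ((1 - a * h)^k * f s)\<bar> \<le> C * (h * sqrt h) + k * (C * (h * sqrt h))"
        using 1 by (simp add: right_diff_distrib)
      then show ?case by (simp add: algebra_simps)
    qed simp
    from this[of n] have "\<bar>f (s + T) - (1 - a * h)^n * f s\<bar> \<le> n * (C * (h * sqrt h))"
      using h by simp
    also have "n * (C * (h * sqrt h)) = C * T * sqrt h"
      using h by (simp add: algebra_simps flip: h(2))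
    finally show ?thesis by (simp add: T_def h_def)
  qed
  have "(\<lambda>n. \<bar>f t - (1 - a * T / n)^n * f s\<bar>) \<longlonglongrightarrow> \<bar>f t - exp (- a * T) * f s\<bar>"
    using tendsto_exp_limit_sequentially[of "- a * T"] by (intro tendsto_intros) auto
  moreover have "(\<lambda>n. C * T * sqrt (T / real n)) \<longlonglongrightarrow> C * T * sqrt 0"
    by (intro tendsto_intros tendsto_divide_0[OF tendsto_const] filterlim_at_top_imp_at_infinity
        filterlim_real_sequentially)
  moreover have "eventually (\<lambda>n. \<bar>f t - (1 - a * T / n)^n * f s\<bar> \<le> C * T * sqrt (T / real n)) sequentially"
    using eventually_gt_at_top[of "nat \<lceil>a * T\<rceil>"] by eventually_elim (rule bound, linarith+)
  ultimately have "\<bar>f t - exp (- a * T) * f s\<bar> \<le> C * T * sqrt 0"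
    by (intro tendsto_le[OF sequentially_bot])
  then show ?thesis by (simp add: T_def)
qed

lemma abs_sinc_le_one: "\<bar>sinc x\<bar> \<le> 1"
  using abs_sin_le_one abs_sin_x_le_abs_x[of x] by (auto simp: divide_le_eq)

text \<open>Fubini moves the integral over \<open>l\<close> inside the expectation, where it equals
  \<open>sgn V * Si (n * \<bar>V\<bar>)\<close>. By the Dirichlet integral this converges to
  \<open>pi / 2 * sgn V\<close>, boundedly since \<open>Si\<close> is bounded. The weight
  \<open>W\<close> will be the indicator of an event from the past.\<close>

lemma (in prob_space) sine_transform_tendsto_sgn:
  fixes V W :: "'a \<Rightarrow> real"
  assumes V: "integrable M V" and W[measurable]: "W \<in> borel_measurable M" and W1: "\<And>\<omega>. \<bar>W \<omega>\<bar> \<le> 1"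
  shows "(\<lambda>n::nat. LBINT l. indicator {0<..<real n} l * (expectation (\<lambda>\<omega>. W \<omega> * sin (l * V \<omega>)) / l))
    \<longlonglongrightarrow> pi / 2 * expectation (\<lambda>\<omega>. W \<omega> * sgn (V \<omega>))"
proof -
  interpret P: pair_sigma_finite lborel M ..
  have V'[measurable]: "V \<in> borel_measurable M" using V by auto
  have eq: "(LBINT l. indicator {0<..<real n} l * (expectation (\<lambda>\<omega>. W \<omega> * sin (l * V \<omega>)) / l))
     = expectation (\<lambda>\<omega>. W \<omega> * (sgn (V \<omega>) * Si (n * \<bar>V \<omega>\<bar>)))" for n :: nat
  proof -
    \<comment> \<open>Writing \<open>sin (l * V) / l\<close> as \<open>V * sinc (l * V)\<close>
      bounds the integrand by \<open>\<bar>V\<bar>\<close> on a bounded range of \<open>l\<close>,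
      so integrability of \<open>V\<close> is what justifies Fubini.\<close>
    let ?f = "\<lambda>(l, \<omega>). indicator {0<..<real n} l * (W \<omega> * (V \<omega> * sinc (l * V \<omega>)))"
    let ?g = "\<lambda>(l, \<omega>). indicator {0<..<real n} l * \<bar>V \<omega>\<bar>"
    have "integrable (lborel \<Otimes>\<^sub>M M) ?g"
    proof (rule P.Fubini_integrable)
      show "integrable lborel (\<lambda>x. LINT y|M. norm (?g (x, y)))"
        using V by (simp add: abs_mult mult.commute)
      show "AE x in lborel. integrable M (\<lambda>y. ?g (x, y))"
        using V by simp
    qed measurable
    then have int: "integrable (lborel \<Otimes>\<^sub>M M) ?f"
    proof (rule Bochner_Integration.integrable_bound)
      have *: "norm (indicator {0<..<real n} l * (W \<omega> * (V \<omega> * s))) \<le> norm (indicator {0<..<real n} l * \<bar>V \<omega>\<bar>)"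
        if "\<bar>s\<bar> \<le> 1" for l s \<omega>
      proof -
        have "\<bar>W \<omega>\<bar> * (\<bar>V \<omega>\<bar> * \<bar>s\<bar>) \<le> 1 * (\<bar>V \<omega>\<bar> * 1)"
          using W1 that by (intro mult_mono) auto
        then show ?thesis by (simp add: abs_mult indicator_def)
      qed
      show "AE x in lborel \<Otimes>\<^sub>M M. norm (?f x) \<le> norm (?g x)"
        unfolding case_prod_beta by (intro AE_I2 * abs_sinc_le_one)
    qed measurable
    have "(LBINT l. indicator {0<..<real n} l * (expectation (\<lambda>\<omega>. W \<omega> * sin (l * V \<omega>)) / l))
      = (LBINT l. expectation (\<lambda>\<omega>. ?f (l, \<omega>)))"
    proof (intro Bochner_Integration.integral_cong refl)
      fix l :: real
      have "indicator {0<..<real n} l * (W \<omega> * (V \<omega> * sinc (l * V \<omega>)))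
          = indicator {0<..<real n} l / l * (W \<omega> * sin (l * V \<omega>))" for \<omega>
        by (auto simp: indicator_def)
      then show "indicator {0<..<real n} l * (expectation (\<lambda>\<omega>. W \<omega> * sin (l * V \<omega>)) / l) =
         expectation (\<lambda>\<omega>. ?f (l, \<omega>))"
        by simp
    qed
    also have "\<dots> = expectation (\<lambda>\<omega>. LBINT l. ?f (l, \<omega>))"
      unfolding prod.case by (rule P.Fubini_integral[OF int, symmetric])
    also have "\<dots> = expectation (\<lambda>\<omega>. W \<omega> * (sgn (V \<omega>) * Si (n * \<bar>V \<omega>\<bar>)))"
    proof (intro Bochner_Integration.integral_cong refl)
      fix \<omega>
      have "(LBINT l. ?f (l, \<omega>)) = W \<omega> * (LBINT l. indicator {0<..<real n} l * (sin (l * V \<omega>) / l))"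
        by (subst integral_mult_right_zero[symmetric], intro Bochner_Integration.integral_cong refl)
           (auto simp: indicator_def)
      also have "(LBINT l. indicator {0<..<real n} l * (sin (l * V \<omega>) / l)) = (LBINT l=0..real n. sin (l * V \<omega>) / l)"
        by (simp add: interval_lebesgue_integral_def set_lebesgue_integral_def zero_ereal_def)
      also have "\<dots> = sgn (V \<omega>) * Si (n * \<bar>V \<omega>\<bar>)"
        by (rule LBINT_I0c_sin_scale_divide) simp
      finally show "(LBINT l. ?f (l, \<omega>)) = W \<omega> * (sgn (V \<omega>) * Si (n * \<bar>V \<omega>\<bar>))" .
    qed
    finally show ?thesis .
  qed
  obtain B where B: "\<And>T. \<bar>Si T\<bar> \<le> B" using bounded_Si by auto
  have B0: "0 \<le> B" using B[of 0] by linarith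
  have "(\<lambda>n::nat. expectation (\<lambda>\<omega>. W \<omega> * (sgn (V \<omega>) * Si (n * \<bar>V \<omega>\<bar>)))) \<longlonglongrightarrow>
      expectation (\<lambda>\<omega>. W \<omega> * (sgn (V \<omega>) * (pi / 2)))"
  proof (rule integral_dominated_convergence[where w="\<lambda>_. B"])
    show "AE \<omega> in M. (\<lambda>n::nat. W \<omega> * (sgn (V \<omega>) * Si (n * \<bar>V \<omega>\<bar>))) \<longlonglongrightarrow> W \<omega> * (sgn (V \<omega>) * (pi / 2))"
    proof (rule AE_I2)
      fix \<omega>
      show "(\<lambda>n::nat. W \<omega> * (sgn (V \<omega>) * Si (n * \<bar>V \<omega>\<bar>))) \<longlonglongrightarrow> W \<omega> * (sgn (V \<omega>) * (pi / 2))"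
      proof (cases "V \<omega> = 0")
        case False
        then have "filterlim (\<lambda>n::nat. \<bar>V \<omega>\<bar> * n) at_top sequentially"
          by (intro filterlim_tendsto_pos_mult_at_top[OF tendsto_const] filterlim_real_sequentially) auto
        then have "(\<lambda>n::nat. Si (\<bar>V \<omega>\<bar> * n)) \<longlonglongrightarrow> pi / 2"
          by (rule filterlim_compose[OF Si_at_top])
        then show ?thesis by (intro tendsto_intros) (simp add: mult.commute)
      qed simp
    qed
    have "\<bar>W \<omega>\<bar> * (\<bar>sgn (V \<omega>)\<bar> * \<bar>Si x\<bar>) \<le> 1 * (1 * B)" for \<omega> x
      using W1 B B0 by (intro mult_mono) (auto simp: abs_sgn_eq)
    then show "AE \<omega> in M. norm (W \<omega> * (sgn (V \<omega>) * Si (n * \<bar>V \<omega>\<bar>))) \<le> B" for n :: nat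
      by (auto simp: abs_mult)
  qed auto
  moreover have "expectation (\<lambda>\<omega>. W \<omega> * (sgn (V \<omega>) * (pi / 2))) = pi / 2 * expectation (\<lambda>\<omega>. W \<omega> * sgn (V \<omega>))"
    by (subst integral_mult_right_zero[symmetric], intro Bochner_Integration.integral_cong) auto
  ultimately show ?thesis unfolding eq by simp
qed

section \<open>Tails, trigonometric integrals and moments of normal laws\<close>

abbreviation "std_normal_tail a \<equiv> measure std_normal_distribution {a..}"

lemma integrable_indicator_std_normal: "integrable lborel (\<lambda>x. indicator {a..} x * std_normal_density x)"
  using integrable_mult_indicator[of "{a..}" lborel std_normal_density] by simp

lemma std_normal_tail_eq: "std_normal_tail a = (LBINT x. indicator {a..} x * std_normal_density x)"
proof -
  interpret real_distribution std_normal_distribution by (rule real_dist_normal_dist)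
  have "std_normal_tail a = (LINT x|std_normal_distribution. indicator {a..} x)" by simp
  also have "\<dots> = (LBINT x. indicator {a..} x * std_normal_density x)"
    by (subst integral_density) (auto simp: mult.commute normal_density_nonneg)
  finally show ?thesis .
qed

text \<open>After the shift by \<open>a\<close>, the inequality
  \<open>(a + x)^2 \<ge> a^2 + x^2\<close> for \<open>x \<ge> 0\<close> splits off the factor
  \<open>exp (- a^2 / 2)\<close>, and the remaining density has total mass 1.\<close>

lemma std_normal_tail_le:
  assumes "0 \<le> a" shows "std_normal_tail a \<le> exp (- a\<^sup>2 / 2)"
proof -
  have "std_normal_tail a = (LBINT x. indicator {a..} (a + 1 * x) * std_normal_density (a + 1 * x))"
    unfolding std_normal_tail_eq using lborel_integral_real_affine[of 1 "\<lambda>x. indicator {a..} x * std_normal_density x" a] by simp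
  also have "\<dots> \<le> (LBINT x. exp (- a\<^sup>2 / 2) * std_normal_density x)"
  proof (rule integral_mono)
    have "integrable lborel (\<lambda>x. indicator {a..} x * std_normal_density x)"
      by (rule integrable_indicator_std_normal)
    then show "integrable lborel (\<lambda>x. indicator {a..} (a + 1 * x) * std_normal_density (a + 1 * x))"
      by (subst lborel_integrable_real_affine_iff[of 1 "\<lambda>x. indicator {a..} x * std_normal_density x" a]) auto
    fix x :: real
    have "std_normal_density (a + x) \<le> exp (- a\<^sup>2 / 2) * std_normal_density x" if "0 \<le> x"
    proof -
      have "- (a + x)\<^sup>2 / 2 \<le> - a\<^sup>2 / 2 + - x\<^sup>2 / 2"
        using that assms by (simp add: power2_sum)
      then show ?thesis
        by (auto simp: std_normal_density_def divide_right_mono simp flip: exp_add)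
    qed
    then show "indicator {a..} (a + 1 * x) * std_normal_density (a + 1 * x) \<le> exp (- a\<^sup>2 / 2) * std_normal_density x"
      by (auto simp: indicator_def normal_density_nonneg)
  qed auto
  also have "\<dots> = exp (- a\<^sup>2 / 2)" by simp
  finally show ?thesis .
qed

text \<open>Only the interval from \<open>a\<close> to \<open>a + 1\<close> is kept, where the
  density is at least its value at the right end. The shift from \<open>a\<close> to
  \<open>a + 1\<close> is harmless for the leading exponent.\<close>

lemma std_normal_tail_ge:
  assumes "0 \<le> a" shows "exp (- (a + 1)\<^sup>2 / 2) / sqrt (2 * pi) \<le> std_normal_tail a"
proof -
  have "exp (- (a + 1)\<^sup>2 / 2) / sqrt (2 * pi) = (LBINT x. indicator {a..a+1} x * (exp (- (a + 1)\<^sup>2 / 2) / sqrt (2 * pi)))"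
    by simp
  also have "\<dots> \<le> (LBINT x. indicator {a..} x * std_normal_density x)"
  proof (rule integral_mono)
    show "integrable lborel (\<lambda>x. indicator {a..} x * std_normal_density x)"
      by (rule integrable_indicator_std_normal)
    fix x :: real
    have "exp (- (a + 1)\<^sup>2 / 2) / sqrt (2 * pi) \<le> std_normal_density x" if "a \<le> x" "x \<le> a + 1"
    proof -
      have "x\<^sup>2 \<le> (a + 1)\<^sup>2" using that assms by (intro power_mono) auto
      then show ?thesis by (auto simp: std_normal_density_def divide_right_mono)
    qed
    then show "indicator {a..a+1} x * (exp (- (a + 1)\<^sup>2 / 2) / sqrt (2 * pi)) \<le> indicator {a..} x * std_normal_density x"
      by (auto simp: indicator_def normal_density_nonneg)
  qed auto
  finally show ?thesis unfolding std_normal_tail_eq .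
qed

lemma std_normal_sin_cos:
  "(LINT x|std_normal_distribution. cos (l * x)) = exp (- l\<^sup>2 / 2)"
  "(LINT x|std_normal_distribution. sin (l * x)) = 0"
proof -
  interpret real_distribution std_normal_distribution by (rule real_dist_normal_dist)
  have int: "integrable std_normal_distribution (\<lambda>x. iexp (l * x))"
    by (rule integrable_iexp) auto
  have "char std_normal_distribution l = complex_of_real (exp (- l\<^sup>2 / 2))"
    by (simp add: char_std_normal_distribution)
  then have c: "(CLINT x|std_normal_distribution. iexp (l * x)) = complex_of_real (exp (- l\<^sup>2 / 2))"
    unfolding char_def .
  show "(LINT x|std_normal_distribution. cos (l * x)) = exp (- l\<^sup>2 / 2)"
    using integral_Re[OF int] c by (simp add: Re_exp)
  show "(LINT x|std_normal_distribution. sin (l * x)) = 0"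
    using integral_Im[OF int] c by (simp add: Im_exp)
qed

text \<open>After the reflection of \<open>x\<close> the sign is 1 below \<open>d / \<sigma>\<close>
  and -1 above it. For \<open>d \<ge> 0\<close> and \<open>\<sigma> = sqrt (2 * t)\<close> the value
  is the reflection-principle probability that a Brownian motion with variance \<open>2 * t\<close>
  at time \<open>t\<close>, started from \<open>d\<close>, has not hit 0 by then.\<close>

lemma std_normal_sgn:
  assumes "0 < \<sigma>"
  shows "(LINT x|std_normal_distribution. sgn (d + \<sigma> * x)) = 1 - 2 * std_normal_tail (d / \<sigma>)"
proof -
  interpret real_distribution std_normal_distribution by (rule real_dist_normal_dist)
  have "(LINT x|std_normal_distribution. sgn (d + \<sigma> * x)) = (LBINT x. std_normal_density x * sgn (d + \<sigma> * x))"
    by (subst integral_density) (auto simp: normal_density_nonneg)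
  also have "\<dots> = (LBINT x. std_normal_density (0 + (-1) * x) * sgn (d + \<sigma> * (0 + (-1) * x)))"
    using lborel_integral_real_affine[of "-1" "\<lambda>x. std_normal_density x * sgn (d + \<sigma> * x)" 0] by simp
  also have "\<dots> = (LBINT x. std_normal_density x - 2 * (indicator {d / \<sigma>..} x * std_normal_density x))"
  proof (rule integral_cong_AE)
    show "AE x in lborel. std_normal_density (0 + - 1 * x) * sgn (d + \<sigma> * (0 + - 1 * x)) =
        std_normal_density x - 2 * (indicator {d / \<sigma>..} x * std_normal_density x)"
      using AE_lborel_singleton[of "d / \<sigma>"]
    proof eventually_elim
      case (elim x)
      then show ?case using assms
        by (cases "x < d / \<sigma>") (auto simp: std_normal_density_def indicator_def field_simps sgn_if)
    qed
  qed auto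
  also have "\<dots> = 1 - 2 * std_normal_tail (d / \<sigma>)"
    unfolding std_normal_tail_eq
    by (subst Bochner_Integration.integral_diff)
      (auto intro!: integrable_indicator_std_normal)
  finally show ?thesis .
qed

lemma (in prob_space) centered_normal_abs_moments:
  assumes X: "distributed M lborel X (normal_density 0 \<sigma>)" and s: "0 < \<sigma>"
  shows "integrable M (\<lambda>\<omega>. \<bar>X \<omega>\<bar>)" "expectation (\<lambda>\<omega>. \<bar>X \<omega>\<bar>) \<le> \<sigma>"
    and "integrable M (\<lambda>\<omega>. \<bar>X \<omega>\<bar>^3)" "expectation (\<lambda>\<omega>. \<bar>X \<omega>\<bar>^3) \<le> 2 * \<sigma>^3"
proof -
  \<comment> \<open>The exact odd moments carry a factor \<open>sqrt (2 / pi)\<close>; dropping it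
    gives the stated constants, with \<open>k = 0\<close> and \<open>k = 1\<close> below.\<close>
  have p: "sqrt (2 / pi) \<le> 1" using pi_gt3 by auto
  have i: "integrable M (\<lambda>\<omega>. \<bar>X \<omega>\<bar>^(2*k+1))" for k
    using integrable_normal_moment_abs[OF s, of 0 "2*k+1"]
      distributed_integrable[OF X, of "\<lambda>x. \<bar>x\<bar>^(2*k+1)"] by (simp add: normal_density_nonneg)
  have e: "expectation (\<lambda>\<omega>. \<bar>X \<omega>\<bar>^(2*k+1)) = 2^k * \<sigma>^(2*k+1) * fact k * sqrt (2/pi)" for k
    using integral_normal_moment_abs_odd[OF s, of 0 k]
      distributed_integral[OF X, of "\<lambda>x. \<bar>x\<bar>^(2*k+1)"] by (simp add: normal_density_nonneg)
  show "integrable M (\<lambda>\<omega>. \<bar>X \<omega>\<bar>)" using i[of 0] by simp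
  show "integrable M (\<lambda>\<omega>. \<bar>X \<omega>\<bar>^3)" using i[of 1] by (simp add: numeral_3_eq_3)
  have "\<sigma> * sqrt (2/pi) \<le> \<sigma> * 1" using p s by (intro mult_left_mono) auto
  then show "expectation (\<lambda>\<omega>. \<bar>X \<omega>\<bar>) \<le> \<sigma>" using e[of 0] by simp
  have "2 * \<sigma>^3 * sqrt (2/pi) \<le> 2 * \<sigma>^3 * 1" using p s by (intro mult_left_mono) auto
  then show "expectation (\<lambda>\<omega>. \<bar>X \<omega>\<bar>^3) \<le> 2 * \<sigma>^3" using e[of 1] by (simp add: numeral_3_eq_3)
qed

section \<open>The flow and its filtration\<close>

locale arratia = prob_space M for M :: "'a measure" +
  fixes y :: "real \<Rightarrow> real \<Rightarrow> 'a \<Rightarrow> real"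
  assumes flow: "arratia_flow M y"
begin

abbreviation F :: "real \<Rightarrow> 'a measure" where "F \<equiv> joint_filtration M y"

lemma wiener: "wiener_process M u (y u)"
  and ordered: "u1 \<le> u2 \<Longrightarrow> AE \<omega> in M. \<forall>t\<ge>0. y u1 t \<omega> \<le> y u2 t \<omega>"
  and covariation: "is_quadratic_covariation M F (\<lambda>t \<omega>. y u1 t \<omega> - u1) (\<lambda>t \<omega>. y u2 t \<omega> - u2)
        (\<lambda>t \<omega>. LINT s:{0..t}|lborel. indicator {s. y u1 s \<omega> = y u2 s \<omega>} s)"
  using flow unfolding arratia_flow_def by auto

lemma measurable_flow[measurable]: "0 \<le> t \<Longrightarrow> y u t \<in> borel_measurable M"
  and flow_0: "\<omega> \<in> space M \<Longrightarrow> y u 0 \<omega> = u"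
  and continuous_flow: "\<omega> \<in> space M \<Longrightarrow> continuous_on {0..} (\<lambda>t. y u t \<omega>)"
  and increment_normal: "0 \<le> s \<Longrightarrow> s < t \<Longrightarrow>
    distributed M lborel (\<lambda>\<omega>. y u t \<omega> - y u s \<omega>) (normal_density 0 (sqrt (t - s)))"
  using wiener[of u] unfolding wiener_process_def by auto

lemma filtration_generators:
  "{y u s -` B \<inter> space M | u s B. 0 \<le> s \<and> s \<le> t \<and> B \<in> sets borel} \<subseteq> sets M"
  by auto

lemma space_filtration[simp]: "space (F t) = space M"
  unfolding joint_filtration_def by (rule space_measure_of_conv)

lemma sets_filtration: "sets (F t) = sigma_sets (space M)
    {y u s -` B \<inter> space M | u s B. 0 \<le> s \<and> s \<le> t \<and> B \<in> sets borel}"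
  unfolding joint_filtration_def by (rule sets_measure_of) auto

lemma subalgebra_filtration: "subalgebra M (F t)"
  unfolding subalgebra_def sets_filtration
  using sets.sigma_sets_subset[OF filtration_generators] by simp

lemma sets_filtration_subset: "A \<in> sets (F t) \<Longrightarrow> A \<in> sets M"
  using subalgebra_filtration by (auto simp: subalgebra_def)

lemma filtration_mono: "s \<le> t \<Longrightarrow> sets (F s) \<subseteq> sets (F t)"
  unfolding sets_filtration by (rule sigma_sets_mono') fastforce

lemma measurable_filtration_mono:
  "f \<in> measurable (F s) N \<Longrightarrow> s \<le> t \<Longrightarrow> f \<in> measurable (F t) N"
  using filtration_mono[of s t] by (auto simp: measurable_def)

lemma measurable_filtration_imp: "f \<in> measurable (F s) N \<Longrightarrow> f \<in> measurable M N"
  by (rule measurable_from_subalg[OF subalgebra_filtration])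

lemma adapted: "0 \<le> s \<Longrightarrow> s \<le> t \<Longrightarrow> y u s \<in> borel_measurable (F t)"
  by (rule measurableI) (auto simp: sets_filtration intro!: sigma_sets.Basic)

lemma integrable_bounded_mult:
  fixes f g :: "'a \<Rightarrow> real"
  assumes "integrable M g" "f \<in> borel_measurable M" "\<And>\<omega>. \<bar>f \<omega>\<bar> \<le> 1"
  shows "integrable M (\<lambda>\<omega>. f \<omega> * g \<omega>)"
proof (rule Bochner_Integration.integrable_bound)
  have "\<bar>f \<omega>\<bar> * \<bar>g \<omega>\<bar> \<le> 1 * \<bar>g \<omega>\<bar>" for \<omega>
    using assms by (intro mult_right_mono) auto
  then show "AE \<omega> in M. norm (f \<omega> * g \<omega>) \<le> norm (g \<omega>)" by (simp add: abs_mult)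
qed (use assms in auto)

text \<open>The conditional expectation identity tested against an \<open>F s\<close>-measurable
  factor. All martingale hypotheses are used in this integrated form.\<close>

lemma martingale_expectation_mult:
  assumes X: "is_martingale M F X" and st: "0 \<le> s" "s \<le> t"
    and f: "f \<in> borel_measurable (F s)" and int: "integrable M (\<lambda>\<omega>. f \<omega> * X t \<omega>)"
  shows "expectation (\<lambda>\<omega>. f \<omega> * X t \<omega>) = expectation (\<lambda>\<omega>. f \<omega> * X s \<omega>)"
proof -
  interpret S: finite_measure_subalgebra M "F s"
    by unfold_locales (rule subalgebra_filtration)
  have [measurable]: "X t \<in> borel_measurable M" "X s \<in> borel_measurable M" "f \<in> borel_measurable M"
    using X st f measurable_filtration_imp[of _ _ borel] unfolding is_martingale_def
    by (meson order_trans)+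
  have "expectation (\<lambda>\<omega>. f \<omega> * X t \<omega>) = expectation (\<lambda>\<omega>. f \<omega> * real_cond_exp M (F s) (X t) \<omega>)"
    by (rule S.real_cond_exp_intg(2)[symmetric]) (use int f in auto)
  also have "\<dots> = expectation (\<lambda>\<omega>. f \<omega> * X s \<omega>)"
  proof (rule integral_cong_AE)
    have "AE \<omega> in M. real_cond_exp M (F s) (X t) \<omega> = X s \<omega>"
      using X st by (simp add: is_martingale_def)
    then show "AE \<omega> in M. f \<omega> * real_cond_exp M (F s) (X t) \<omega> = f \<omega> * X s \<omega>"
      by eventually_elim simp
  qed auto
  finally show ?thesis .
qed

end

section \<open>The gap between two particles\<close>

locale arratia_pair = arratia +
  fixes u1 u2 :: real
  assumes u12: "u1 \<le> u2"
begin

definition gap :: "real \<Rightarrow> 'a \<Rightarrow> real" where "gap t \<omega> = y u2 t \<omega> - y u1 t \<omega>"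

text \<open>The covariation that the flow prescribes for the two particles, that is, the time the
  gap has spent at 0. Accordingly the bracket of the gap is
  \<open>2 * t - 2 * meet_time t\<close>.\<close>

definition meet_time :: "real \<Rightarrow> 'a \<Rightarrow> real" where
  "meet_time t \<omega> = (LINT s:{0..t}|lborel. indicator {s. y u1 s \<omega> = y u2 s \<omega>} s)"

lemma measurable_gap[measurable]: "0 \<le> t \<Longrightarrow> gap t \<in> borel_measurable M"
  unfolding gap_def by simp

lemma adapted_gap: "0 \<le> s \<Longrightarrow> s \<le> t \<Longrightarrow> gap s \<in> borel_measurable (F t)"
  unfolding gap_def[abs_def] using adapted by simp

lemma gap_nonneg: "AE \<omega> in M. \<forall>t\<ge>0. 0 \<le> gap t \<omega>"
  using ordered[OF u12] by (simp add: gap_def)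

lemma gap_0: "\<omega> \<in> space M \<Longrightarrow> gap 0 \<omega> = u2 - u1"
  by (simp add: gap_def flow_0)

lemma continuous_gap: "\<omega> \<in> space M \<Longrightarrow> continuous_on {0..} (\<lambda>t. gap t \<omega>)"
  unfolding gap_def by (intro continuous_intros continuous_flow)

lemma flow_martingale: "is_martingale M F (\<lambda>t \<omega>. y u t \<omega> - u)"
  and flow_square_integrable: "0 \<le> t \<Longrightarrow> integrable M (\<lambda>\<omega>. (y u t \<omega> - u)\<^sup>2)"
  using covariation[of u u]
  by (auto simp: is_quadratic_covariation_def square_integrable_martingale_def)

lemma flow_integrable: "0 \<le> t \<Longrightarrow> integrable M (\<lambda>\<omega>. y u t \<omega> - u)"
  using flow_martingale[of u] by (simp add: is_martingale_def)

lemma gap_integrable: "0 \<le> t \<Longrightarrow> integrable M (gap t)"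
proof -
  assume "0 \<le> t"
  then have "integrable M (\<lambda>\<omega>. (y u2 t \<omega> - u2) - (y u1 t \<omega> - u1) + (u2 - u1))"
    by (intro Bochner_Integration.integrable_add Bochner_Integration.integrable_diff flow_integrable) auto
  then show ?thesis by (simp add: gap_def[abs_def])
qed

text \<open>Two different times are allowed because expanding a squared increment produces products
  of a value at \<open>s\<close> with a value at \<open>t\<close>.\<close>

lemma flow_product_integrable:
  assumes "0 \<le> s" "0 \<le> t"
  shows "integrable M (\<lambda>\<omega>. (y u s \<omega> - u) * (y v t \<omega> - v))"
proof (rule Bochner_Integration.integrable_bound)
  show "integrable M (\<lambda>\<omega>. (y u s \<omega> - u)\<^sup>2 + (y v t \<omega> - v)\<^sup>2)"
    using assms flow_square_integrable by simp
  have "\<bar>a * b\<bar> \<le> a\<^sup>2 + b\<^sup>2" for a b :: real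
    using sum_squares_bound[of "\<bar>a\<bar>" "\<bar>b\<bar>"] mult_nonneg_nonneg[of "\<bar>a\<bar>" "\<bar>b\<bar>"]
    unfolding abs_mult power2_abs by linarith
  then show "AE \<omega> in M. norm ((y u s \<omega> - u) * (y v t \<omega> - v)) \<le> norm ((y u s \<omega> - u)\<^sup>2 + (y v t \<omega> - v)\<^sup>2)"
    by (simp add: order_trans[OF _ abs_ge_self])
qed (use assms in measurable)

lemma gap_martingale_mult:
  assumes st: "0 \<le> s" "s \<le> t" and f: "f \<in> borel_measurable (F s)" and f1: "\<And>\<omega>. \<bar>f \<omega>\<bar> \<le> 1"
  shows "expectation (\<lambda>\<omega>. f \<omega> * gap t \<omega>) = expectation (\<lambda>\<omega>. f \<omega> * gap s \<omega>)"
proof -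
  have fM: "f \<in> borel_measurable M" by (rule measurable_filtration_imp[OF f])
  have i: "integrable M (\<lambda>\<omega>. f \<omega> * (y u r \<omega> - u))" if "0 \<le> r" for u r
    using that by (intro integrable_bounded_mult flow_integrable fM f1)
  have c: "integrable M f"
    using integrable_bounded_mult[OF integrable_const[of 1] fM f1] by simp
  have e: "expectation (\<lambda>\<omega>. f \<omega> * gap r \<omega>) = expectation (\<lambda>\<omega>. f \<omega> * (y u2 r \<omega> - u2))
       - expectation (\<lambda>\<omega>. f \<omega> * (y u1 r \<omega> - u1)) + (u2 - u1) * expectation f" if "0 \<le> r" for r
  proof -
    have "f \<omega> * gap r \<omega> = f \<omega> * (y u2 r \<omega> - u2) - f \<omega> * (y u1 r \<omega> - u1) + (u2 - u1) * f \<omega>" for \<omega>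
      by (simp add: gap_def algebra_simps)
    then show ?thesis using i[OF that] c by simp
  qed
  show ?thesis
    using st by (simp add: e martingale_expectation_mult[OF flow_martingale st f i])
qed

lemma covariation_self:
  assumes "0 \<le> t"
  shows "(LINT s:{0..t}|lborel. indicator {s. y u s \<omega> = y u s \<omega>} s) = (t :: real)"
proof -
  have "(LINT s:{0..t}|lborel. indicator {s. y u s \<omega> = y u s \<omega>} s) = (LINT s:{0..t}|lborel. 1 :: real)"
    by simp
  also have "\<dots> = t" using assms unfolding set_lebesgue_integral_def by simp
  finally show ?thesis .
qed

text \<open>The bracket of the gap in conditional form: the brackets of the two particles contribute
  \<open>t - s\<close> each, and their covariation is subtracted twice.\<close>

lemma gap_increment_square_mult:
  assumes st: "0 \<le> s" "s \<le> t" and f: "f \<in> borel_measurable (F s)" and f1: "\<And>\<omega>. \<bar>f \<omega>\<bar> \<le> 1"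
  shows "integrable M (\<lambda>\<omega>. f \<omega> * (gap t \<omega> - gap s \<omega>)\<^sup>2)"
    and "integrable M (\<lambda>\<omega>. f \<omega> * (meet_time t \<omega> - meet_time s \<omega>))"
    and "expectation (\<lambda>\<omega>. f \<omega> * (gap t \<omega> - gap s \<omega>)\<^sup>2) =
      2 * (t - s) * expectation f - 2 * expectation (\<lambda>\<omega>. f \<omega> * (meet_time t \<omega> - meet_time s \<omega>))"
proof -
  let ?X = "\<lambda>u t \<omega>. y u t \<omega> - u"
  have fM[measurable]: "f \<in> borel_measurable M" by (rule measurable_filtration_imp[OF f])
  have t: "0 \<le> t" using st by simp
  \<comment> \<open>The compensated products, which are martingales by the covariation axiom; the
    diagonal case \<open>u = v\<close> has compensator \<open>r\<close>.\<close>
  define N where "N u v r \<omega> = ?X u r \<omega> * ?X v r \<omega> -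
    (LINT s:{0..r}|lborel. indicator {s. y u s \<omega> = y v s \<omega>} s)" for u v r \<omega>
  have N: "is_martingale M F (N u v)" for u v
    using covariation[of u v] unfolding N_def[abs_def] is_quadratic_covariation_def by blast
  then have Ni: "0 \<le> r \<Longrightarrow> integrable M (N u v r)" for u v r
    by (simp add: is_martingale_def)
  have NA: "N u1 u2 r \<omega> = ?X u1 r \<omega> * ?X u2 r \<omega> - meet_time r \<omega>" for r \<omega>
    by (simp add: N_def meet_time_def)
  have Ns: "N u u r \<omega> = ?X u r \<omega> * ?X u r \<omega> - r" if "0 \<le> r" for u r \<omega>
    by (simp only: N_def covariation_self[OF that])
  have fN: "integrable M (\<lambda>\<omega>. f \<omega> * N u v r \<omega>)" if "0 \<le> r" for u v r
    using that by (intro integrable_bounded_mult Ni fM f1)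
  have fNe: "expectation (\<lambda>\<omega>. f \<omega> * N u v t \<omega>) = expectation (\<lambda>\<omega>. f \<omega> * N u v s \<omega>)" for u v
    by (rule martingale_expectation_mult[OF N st f fN[OF t]])
  have c: "integrable M f"
    using integrable_bounded_mult[OF integrable_const[of 1] fM f1] by simp
  have xx: "integrable M (\<lambda>\<omega>. f \<omega> * (?X u r \<omega> * ?X v q \<omega>))" if "0 \<le> r" "0 \<le> q" for u v r q
    using that by (intro integrable_bounded_mult flow_product_integrable fM f1)
  have xxe: "expectation (\<lambda>\<omega>. f \<omega> * (?X u s \<omega> * ?X v t \<omega>)) = expectation (\<lambda>\<omega>. f \<omega> * (?X u s \<omega> * ?X v s \<omega>))" for u v
  proof -
    have [measurable]: "y u s \<in> borel_measurable (F s)" using adapted st by simp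
    have "(\<lambda>\<omega>. f \<omega> * ?X u s \<omega>) \<in> borel_measurable (F s)" using f by simp
    from martingale_expectation_mult[OF flow_martingale st this, of v] xx[OF st(1) t, of u v]
    show ?thesis by (simp add: mult.assoc)
  qed
  have A_eq: "meet_time r \<omega> = ?X u1 r \<omega> * ?X u2 r \<omega> - N u1 u2 r \<omega>" for r \<omega>
    by (simp add: NA)
  have Ai: "integrable M (meet_time r)" if "0 \<le> r" for r
    unfolding A_eq[abs_def] using that Ni flow_product_integrable by simp
  show iA: "integrable M (\<lambda>\<omega>. f \<omega> * (meet_time t \<omega> - meet_time s \<omega>))"
    using Ai t st by (intro integrable_bounded_mult Bochner_Integration.integrable_diff fM f1)
  \<comment> \<open>A purely algebraic expansion, arranged so that every parenthesised difference
    involving \<open>N\<close> or products of \<open>?X\<close> has expectation 0: those with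
    \<open>N\<close> by \<open>fNe\<close>, the products across times by \<open>xxe\<close>. Only
    the last line survives.\<close>
  have Z2: "f \<omega> * (gap t \<omega> - gap s \<omega>)\<^sup>2 = (f \<omega> * N u2 u2 t \<omega> - f \<omega> * N u2 u2 s \<omega>) + (f \<omega> * N u1 u1 t \<omega> - f \<omega> * N u1 u1 s \<omega>)
      - 2 * (f \<omega> * N u1 u2 t \<omega> - f \<omega> * N u1 u2 s \<omega>)
      - 2 * (f \<omega> * (?X u2 s \<omega> * ?X u2 t \<omega>) - f \<omega> * (?X u2 s \<omega> * ?X u2 s \<omega>))
      - 2 * (f \<omega> * (?X u1 s \<omega> * ?X u1 t \<omega>) - f \<omega> * (?X u1 s \<omega> * ?X u1 s \<omega>))
      + 2 * (f \<omega> * (?X u1 s \<omega> * ?X u2 t \<omega>) - f \<omega> * (?X u1 s \<omega> * ?X u2 s \<omega>))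
      + 2 * (f \<omega> * (?X u2 s \<omega> * ?X u1 t \<omega>) - f \<omega> * (?X u2 s \<omega> * ?X u1 s \<omega>))
      + 2 * (t - s) * f \<omega> - 2 * (f \<omega> * (meet_time t \<omega> - meet_time s \<omega>))" for \<omega>
    unfolding NA Ns[OF t] Ns[OF st(1)] by (simp add: gap_def power2_eq_square algebra_simps)
  show "integrable M (\<lambda>\<omega>. f \<omega> * (gap t \<omega> - gap s \<omega>)\<^sup>2)"
    unfolding Z2 using fN xx c iA t st(1) by simp
  show "expectation (\<lambda>\<omega>. f \<omega> * (gap t \<omega> - gap s \<omega>)\<^sup>2) =
      2 * (t - s) * expectation f - 2 * expectation (\<lambda>\<omega>. f \<omega> * (meet_time t \<omega> - meet_time s \<omega>))"
  proof -
    have "expectation (\<lambda>\<omega>. f \<omega> * (?X u2 s \<omega> * ?X u1 s \<omega>)) = expectation (\<lambda>\<omega>. f \<omega> * (?X u1 s \<omega> * ?X u2 s \<omega>))"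
      by (rule Bochner_Integration.integral_cong) auto
    then show ?thesis
      unfolding Z2 using fN xx c iA t st(1) fNe xxe by simp
  qed
qed

text \<open>Optional stopping on a finite set of times. The induction adds the largest time
  \<open>b\<close>; the event \<open>C\<close> that the gap is small for the first time at
  \<open>b\<close> lies in \<open>F b\<close>, so on \<open>C\<close> the martingale property
  replaces \<open>gap t\<close> by \<open>gap b\<close>, which is below \<open>e\<close>.\<close>

lemma gap_after_small_values:
  assumes S: "finite S" "S \<subseteq> {0..t}" and e: "0 < e"
  shows "expectation (\<lambda>\<omega>. indicator {\<omega> \<in> space M. \<exists>v\<in>S. gap v \<omega> < e} \<omega> * gap t \<omega>)
    \<le> e * prob {\<omega> \<in> space M. \<exists>v\<in>S. gap v \<omega> < e}"
  using S
proof (induction S rule: finite_linorder_max_induct)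
  case (insert b S)
  let ?E = "\<lambda>S. {\<omega> \<in> space M. \<exists>v\<in>S. gap v \<omega> < e}"
  define C where "C = {\<omega> \<in> space M. gap b \<omega> < e} - ?E S"
  have b: "0 \<le> b" "b \<le> t" "0 \<le> t" using insert.prems by auto
  have meas: "?E T \<in> sets (F b)" if "T \<subseteq> insert b S" for T
  proof -
    have "{\<omega> \<in> space (F b). gap v \<omega> < e} \<in> sets (F b)" if "v \<in> insert b S" for v
    proof -
      have "v \<in> {0..t}" "v = b \<or> v < b" using insert.hyps(2) insert.prems that by blast+
      then have [measurable]: "gap v \<in> borel_measurable (F b)" by (intro adapted_gap) auto
      show ?thesis by measurable
    qed
    then have "(\<Union>v\<in>T. {\<omega> \<in> space M. gap v \<omega> < e}) \<in> sets (F b)"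
      using that by (intro sets.finite_UN finite_subset[OF that]) (auto simp: insert.hyps(1))
    also have "(\<Union>v\<in>T. {\<omega> \<in> space M. gap v \<omega> < e}) = ?E T" by auto
    finally show ?thesis .
  qed
  have "C = ?E {b} - ?E S" by (auto simp: C_def)
  then have C: "C \<in> sets (F b)" using meas[of "{b}"] meas[of S] by auto
  have CM[measurable]: "C \<in> sets M" and EM[measurable]: "?E S \<in> sets M"
    using sets_filtration_subset[OF C] sets_filtration_subset[OF meas[of S]] by auto
  have split: "?E (insert b S) = ?E S \<union> C" "?E S \<inter> C = {}" by (auto simp: C_def)
  have ind: "indicator (?E (insert b S)) \<omega> = (indicator (?E S) \<omega> + indicator C \<omega> :: real)" for \<omega>
    using split(2) unfolding split(1) by (auto simp: indicator_def)
  have i: "integrable M (\<lambda>\<omega>. indicator D \<omega> * gap r \<omega>)" if "0 \<le> r" "D \<in> sets M" for r and D :: "'a set"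
    using that gap_integrable by (intro integrable_bounded_mult) (auto simp: indicator_def)
  have "expectation (\<lambda>\<omega>. indicator C \<omega> * gap t \<omega>) = expectation (\<lambda>\<omega>. indicator C \<omega> * gap b \<omega>)"
    using b C by (intro gap_martingale_mult borel_measurable_indicator) (auto simp: indicator_def)
  also have "\<dots> \<le> expectation (\<lambda>\<omega>. e * indicator C \<omega>)"
  proof (rule integral_mono[OF i[OF b(1) CM]])
    show "indicator C \<omega> * gap b \<omega> \<le> e * indicator C \<omega>" for \<omega>
      by (cases "\<omega> \<in> C") (auto simp: C_def)
  qed (simp add: integrable_real_indicator less_top[symmetric])
  also have "\<dots> = e * prob C" by simp
  finally have "expectation (\<lambda>\<omega>. indicator C \<omega> * gap t \<omega>) \<le> e * prob C" .
  moreover have "expectation (\<lambda>\<omega>. indicator (?E S) \<omega> * gap t \<omega>) \<le> e * prob (?E S)"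
    using insert.IH insert.prems by simp
  moreover have "prob (?E (insert b S)) = prob (?E S) + prob C"
    unfolding split(1) by (intro finite_measure_Union split(2) CM EM)
  moreover have "expectation (\<lambda>\<omega>. indicator (?E (insert b S)) \<omega> * gap t \<omega>) =
     expectation (\<lambda>\<omega>. indicator (?E S) \<omega> * gap t \<omega>) + expectation (\<lambda>\<omega>. indicator C \<omega> * gap t \<omega>)"
    unfolding ind distrib_right using b by (intro Bochner_Integration.integral_add i) auto
  ultimately show ?case by (simp add: distrib_left)
qed simp

text \<open>A nonnegative continuous martingale stays at 0 once it gets there. The preceding bound
  makes \<open>gap t\<close> have expectation 0 on the event \<open>H\<close> that the gap comes
  arbitrarily close to 0 on a countable dense set of times, and by continuity a zero at any earlier
  time puts the path in \<open>H\<close>.\<close>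

lemma gap_sticky:
  assumes t: "0 \<le> t"
  shows "AE \<omega> in M. \<forall>v\<in>{0..t}. gap v \<omega> = 0 \<longrightarrow> gap t \<omega> = 0"
proof -
  obtain D where D: "countable D" "D \<subseteq> {0..t}" "{0..t} \<subseteq> closure D"
    using separable by blast
  have ne: "D \<noteq> {}" using D(3) t by auto
  \<comment> \<open>Finitely many times are used at once, so that the finite bound applies;
    \<open>E e n\<close> increases to \<open>G e\<close> as \<open>n\<close> grows.\<close>
  define E where "E e n = {\<omega> \<in> space M. \<exists>v\<in>from_nat_into D ` {..<n::nat}. gap v \<omega> < e}" for e n
  define G where "G e = (\<Union>n. E e n)" for e
  have dD: "from_nat_into D k \<in> D" for k by (rule from_nat_into[OF ne])
  then have "from_nat_into D k \<in> {0..t}" for k by (rule subsetD[OF D(2)])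
  then have d0: "0 \<le> from_nat_into D k" for k by simp
  have E_UN: "E e n = (\<Union>k<n. {\<omega> \<in> space M. gap (from_nat_into D k) \<omega> < e})" for e n
    by (auto simp: E_def)
  have [measurable]: "E e n \<in> sets M" for e n
    unfolding E_UN
  proof (intro sets.finite_UN)
    show "{\<omega> \<in> space M. gap (from_nat_into D k) \<omega> < e} \<in> sets M" for k
      using measurable_gap[OF d0[of k]] by measurable
  qed auto
  have [measurable]: "G e \<in> sets M" for e unfolding G_def by measurable
  have inc: "m \<le> n \<Longrightarrow> E e m \<subseteq> E e n" for e m n unfolding E_def by force
  have Zi: "integrable M (gap t)" by (rule gap_integrable[OF t])
  have bound: "expectation (\<lambda>\<omega>. indicator (G e) \<omega> * gap t \<omega>) \<le> e" if e: "0 < e" for e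
  proof (rule LIMSEQ_le_const2)
    show "(\<lambda>n. expectation (\<lambda>\<omega>. indicator (E e n) \<omega> * gap t \<omega>)) \<longlonglongrightarrow> expectation (\<lambda>\<omega>. indicator (G e) \<omega> * gap t \<omega>)"
    proof (rule integral_dominated_convergence[where w="\<lambda>\<omega>. \<bar>gap t \<omega>\<bar>"])
      show "AE \<omega> in M. (\<lambda>n. indicator (E e n) \<omega> * gap t \<omega>) \<longlonglongrightarrow> indicator (G e) \<omega> * gap t \<omega>"
        unfolding G_def
        by (intro AE_I2 tendsto_intros LIMSEQ_indicator_incseq) (auto simp: incseq_def inc)
    qed (use Zi t in \<open>auto simp: indicator_def\<close>)
    have "expectation (\<lambda>\<omega>. indicator (E e n) \<omega> * gap t \<omega>) \<le> e" for n
    proof -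
      have "from_nat_into D ` {..<n} \<subseteq> {0..t}" using dD D by blast
      from gap_after_small_values[OF _ this e]
      have "expectation (\<lambda>\<omega>. indicator (E e n) \<omega> * gap t \<omega>) \<le> e * prob (E e n)"
        by (simp add: E_def)
      also have "\<dots> \<le> e * 1" using e by (intro mult_left_mono) auto
      finally show ?thesis by simp
    qed
    then show "\<exists>N. \<forall>n\<ge>N. expectation (\<lambda>\<omega>. indicator (E e n) \<omega> * gap t \<omega>) \<le> e" by auto
  qed
  define H where "H = (\<Inter>k. G (1 / Suc k))"
  have [measurable]: "H \<in> sets M" unfolding H_def by measurable
  have i: "integrable M (\<lambda>\<omega>. indicator C \<omega> * gap t \<omega>)" if "C \<in> sets M" for C :: "'a set"
    using that Zi by (intro integrable_bounded_mult) (auto simp: indicator_def)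
  have pos: "AE \<omega> in M. 0 \<le> indicator H \<omega> * gap t \<omega>"
    using gap_nonneg by eventually_elim (use t in \<open>auto simp: indicator_def\<close>)
  have "expectation (\<lambda>\<omega>. indicator H \<omega> * gap t \<omega>) \<le> 1 / Suc k" for k
  proof -
    have "expectation (\<lambda>\<omega>. indicator H \<omega> * gap t \<omega>) \<le> expectation (\<lambda>\<omega>. indicator (G (1 / Suc k)) \<omega> * gap t \<omega>)"
    proof (rule integral_mono_AE)
      show "AE \<omega> in M. indicator H \<omega> * gap t \<omega> \<le> indicator (G (1 / Suc k)) \<omega> * gap t \<omega>"
        using gap_nonneg by eventually_elim (use t in \<open>auto simp: indicator_def H_def\<close>)
    qed (auto intro: i)
    also have "\<dots> \<le> 1 / Suc k" by (rule bound) simp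
    finally show ?thesis .
  qed
  then have "expectation (\<lambda>\<omega>. indicator H \<omega> * gap t \<omega>) \<le> 0"
    by (intro LIMSEQ_le_const[OF LIMSEQ_inverse_real_of_nat]) (auto simp: inverse_eq_divide)
  then have "expectation (\<lambda>\<omega>. indicator H \<omega> * gap t \<omega>) = 0"
    using integral_nonneg_AE[OF pos] by simp
  then have "AE \<omega> in M. indicator H \<omega> * gap t \<omega> = 0"
    by (subst (asm) integral_nonneg_eq_0_iff_AE[OF i pos]) auto
  then show ?thesis
  proof (rule AE_mp, intro AE_I2 impI ballI)
    fix \<omega> v assume \<omega>: "\<omega> \<in> space M" and 0: "indicator H \<omega> * gap t \<omega> = 0"
      and v: "v \<in> {0..t}" "gap v \<omega> = 0"
    have "\<omega> \<in> G e" if "0 < e" for e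
    proof -
      \<comment> \<open>The zero at \<open>v\<close> may lie outside \<open>D\<close>; path
        continuity gives values below \<open>e\<close> at points of \<open>D\<close> close to
        \<open>v\<close>.\<close>
      have "v \<in> closure D" using v(1) D(3) by blast
      then obtain x where x: "\<And>n. x n \<in> D" "x \<longlonglongrightarrow> v"
        unfolding closure_sequential by blast
      have "x n \<in> {0..}" for n using subsetD[OF D(2) x(1)] by simp
      then have "(\<lambda>n. gap (x n) \<omega>) \<longlonglongrightarrow> gap v \<omega>"
        using v by (intro continuous_on_tendsto_compose[OF continuous_gap[OF \<omega>] x(2)]) (simp_all add: always_eventually)
      then have "eventually (\<lambda>n. gap (x n) \<omega> < e) sequentially"
        using that v by (intro order_tendstoD) auto
      then obtain n where "gap (x n) \<omega> < e" by (auto simp: eventually_sequentially)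
      moreover obtain k where "from_nat_into D k = x n"
        using from_nat_into_surj[OF D(1) x(1)] by blast
      ultimately have "\<omega> \<in> E e (Suc k)" using \<omega> by (force simp: E_UN)
      then show ?thesis by (auto simp: G_def)
    qed
    then have "\<omega> \<in> H" by (simp add: H_def)
    then show "gap t \<omega> = 0" using 0 by simp
  qed
qed

section \<open>Short-time moments and the decay of the sine transform\<close>

text \<open>Each particle's increment is normal with variance \<open>h\<close>, but the joint law of
  the two is unknown at this point, so the moments are bounded by the triangle inequality. The 16 is
  four times the third-moment constant 2, once for each particle.\<close>

lemma gap_increment_moments:
  assumes "0 \<le> r" "0 < h"
  shows "integrable M (\<lambda>\<omega>. \<bar>gap (r + h) \<omega> - gap r \<omega>\<bar>)"
    and "expectation (\<lambda>\<omega>. \<bar>gap (r + h) \<omega> - gap r \<omega>\<bar>) \<le> 2 * sqrt h"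
    and "integrable M (\<lambda>\<omega>. \<bar>gap (r + h) \<omega> - gap r \<omega>\<bar>^3)"
    and "expectation (\<lambda>\<omega>. \<bar>gap (r + h) \<omega> - gap r \<omega>\<bar>^3) \<le> 16 * (h * sqrt h)"
proof -
  let ?d = "\<lambda>u \<omega>. y u (r + h) \<omega> - y u r \<omega>"
  have "distributed M lborel (?d u) (normal_density 0 (sqrt h))" for u
    using increment_normal[of r "r + h" u] assms by simp
  note m = centered_normal_abs_moments[OF this, simplified, OF assms(2)]
  have Zd: "gap (r + h) \<omega> - gap r \<omega> = ?d u2 \<omega> - ?d u1 \<omega>" for \<omega> by (simp add: gap_def)
  show i1: "integrable M (\<lambda>\<omega>. \<bar>gap (r + h) \<omega> - gap r \<omega>\<bar>)"
    using assms gap_integrable by (intro integrable_abs Bochner_Integration.integrable_diff) auto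
  have "expectation (\<lambda>\<omega>. \<bar>gap (r + h) \<omega> - gap r \<omega>\<bar>) \<le> expectation (\<lambda>\<omega>. \<bar>?d u2 \<omega>\<bar> + \<bar>?d u1 \<omega>\<bar>)"
    using i1 m(1) by (intro integral_mono) (auto simp: Zd)
  also have "\<dots> \<le> 2 * sqrt h" using m(1) m(2)[of u1] m(2)[of u2] by simp
  finally show "expectation (\<lambda>\<omega>. \<bar>gap (r + h) \<omega> - gap r \<omega>\<bar>) \<le> 2 * sqrt h" .
  have cube: "\<bar>a - b\<bar>^3 \<le> 4 * \<bar>a\<bar>^3 + 4 * \<bar>b\<bar>^3" for a b :: real
  proof -
    have "\<bar>a - b\<bar>^3 \<le> (\<bar>a\<bar> + \<bar>b\<bar>)^3" by (intro power_mono) auto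
    \<comment> \<open>The defect in the cubic inequality is written as a visibly nonnegative
      product.\<close>
    also have "\<dots> = 4 * \<bar>a\<bar>^3 + 4 * \<bar>b\<bar>^3 - 3 * ((\<bar>a\<bar> + \<bar>b\<bar>) * (\<bar>a\<bar> - \<bar>b\<bar>)\<^sup>2)"
      by algebra
    also have "\<dots> \<le> 4 * \<bar>a\<bar>^3 + 4 * \<bar>b\<bar>^3" by simp
    finally show ?thesis .
  qed
  have i4: "integrable M (\<lambda>\<omega>. 4 * \<bar>?d u2 \<omega>\<bar>^3 + 4 * \<bar>?d u1 \<omega>\<bar>^3)"
    using m(3) by simp
  show i3: "integrable M (\<lambda>\<omega>. \<bar>gap (r + h) \<omega> - gap r \<omega>\<bar>^3)"
    using assms cube by (intro Bochner_Integration.integrable_bound[OF i4]) (auto simp: Zd intro!: order_trans[OF cube])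
  have "expectation (\<lambda>\<omega>. \<bar>gap (r + h) \<omega> - gap r \<omega>\<bar>^3) \<le> expectation (\<lambda>\<omega>. 4 * \<bar>?d u2 \<omega>\<bar>^3 + 4 * \<bar>?d u1 \<omega>\<bar>^3)"
    using i3 i4 cube by (intro integral_mono) (auto simp: Zd)
  also have "\<dots> \<le> 16 * sqrt h ^ 3" using m(3) m(4)[of u1] m(4)[of u2] by simp
  also have "sqrt h ^ 3 = h * sqrt h" using assms by (simp add: power3_eq_cube)
  finally show "expectation (\<lambda>\<omega>. \<bar>gap (r + h) \<omega> - gap r \<omega>\<bar>^3) \<le> 16 * (h * sqrt h)" .
qed

text \<open>A path that is not at 0 at time \<open>r + h\<close> has, by absorption, never been
  there before, so its meeting time is constant on the interval. Otherwise the increment lies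
  between 0 and \<open>h\<close>.\<close>

lemma meet_time_increment:
  assumes \<omega>: "\<omega> \<in> space M" and r: "0 \<le> r" "0 < h"
    and sticky: "\<And>v. v \<in> {0..r + h} \<Longrightarrow> gap v \<omega> = 0 \<Longrightarrow> gap (r + h) \<omega> = 0"
  shows "\<bar>meet_time (r + h) \<omega> - meet_time r \<omega>\<bar> \<le> h * of_bool (gap (r + h) \<omega> = 0)"
proof -
  let ?I = "\<lambda>s. indicator {s. y u1 s \<omega> = y u2 s \<omega>} s :: real"
  \<comment> \<open>Measurability of the meeting set comes from its being closed. It is restricted
    to nonnegative times because paths are unconstrained at negative ones.\<close>
  have "continuous_on {0..} (\<lambda>s. y u1 s \<omega> - y u2 s \<omega>)"
    by (intro continuous_intros continuous_flow \<omega>)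
  then have "closed {s \<in> {0..}. y u1 s \<omega> - y u2 s \<omega> = 0}"
    by (intro continuous_closed_preimage_constant) auto
  then have borel: "{s \<in> {0..}. y u1 s \<omega> = y u2 s \<omega>} \<in> sets borel" by (simp add: borel_closed)
  have I: "set_integrable lborel S ?I" if "S \<in> sets borel" "S \<subseteq> {0..r+h}" for S
  proof -
    have "S \<inter> {s \<in> {0..}. y u1 s \<omega> = y u2 s \<omega>} \<in> sets lborel" using that borel by auto
    moreover have "emeasure lborel (S \<inter> {s \<in> {0..}. y u1 s \<omega> = y u2 s \<omega>}) \<le> emeasure lborel {0..r+h}"
      using that by (intro emeasure_mono) auto
    then have "emeasure lborel (S \<inter> {s \<in> {0..}. y u1 s \<omega> = y u2 s \<omega>}) < \<infinity>"
      using r by (auto simp: le_less_trans)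
    ultimately have "integrable lborel (indicator (S \<inter> {s \<in> {0..}. y u1 s \<omega> = y u2 s \<omega>}) :: _ \<Rightarrow> real)"
      by (rule integrable_real_indicator)
    also have "indicator (S \<inter> {s \<in> {0..}. y u1 s \<omega> = y u2 s \<omega>}) = (\<lambda>s. indicator S s *\<^sub>R ?I s)"
      using that by (auto simp: indicator_def fun_eq_iff)
    finally show ?thesis unfolding set_integrable_def .
  qed
  have "{0..r+h} = {0..r} \<union> {r<..r+h}" using r by auto
  then have "meet_time (r + h) \<omega> = meet_time r \<omega> + (LINT s:{r<..r+h}|lborel. ?I s)"
    unfolding meet_time_def using r by (simp, intro set_integral_Un I) auto
  then have eq: "meet_time (r + h) \<omega> - meet_time r \<omega> = (LINT s:{r<..r+h}|lborel. ?I s)" by simp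
  show ?thesis
  proof (cases "gap (r + h) \<omega> = 0")
    case True
    have "0 \<le> (LINT s:{r<..r+h}|lborel. ?I s)"
      unfolding set_lebesgue_integral_def by (intro integral_nonneg_AE) (auto simp: indicator_def)
    moreover have "(LINT s:{r<..r+h}|lborel. ?I s) \<le> (LINT s:{r<..r+h}|lborel. 1)"
    proof (intro set_integral_mono I)
      show "set_integrable lborel {r<..r+h} (\<lambda>_. 1 :: real)"
        using r by (auto simp: set_integrable_def intro!: integrable_real_indicator)
    qed (use r in \<open>auto simp: indicator_def\<close>)
    moreover have "(LINT s:{r<..r+h}|lborel. 1) = h"
      using r by (simp add: set_lebesgue_integral_def)
    ultimately show ?thesis using True eq by simp
  next
    case False
    have "?I s = 0" if "s \<in> {r<..r+h}" for s
      using sticky[of s] False that r by (auto simp: gap_def indicator_def)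
    then have "(LINT s:{r<..r+h}|lborel. ?I s) = (LINT s:{r<..r+h}|lborel. 0)"
      by (intro set_lebesgue_integral_cong) auto
    then show ?thesis using eq False by simp
  qed
qed

text \<open>Ito's formula by hand, as a local estimate for the Euler lemma. In the Taylor expansion
  of the sine the first-order term vanishes by the martingale property, the second-order term gives
  the decay rate \<open>l^2\<close>, and the correction by the meeting time is negligible because
  the sine is small near absorption.\<close>

lemma sine_transform_decay:
  assumes st: "0 \<le> s" "s < t" and W: "W \<in> borel_measurable (F s)" and W1: "\<And>\<omega>. \<bar>W \<omega>\<bar> \<le> 1"
  shows "expectation (\<lambda>\<omega>. W \<omega> * sin (l * gap t \<omega>)) =
    exp (- l\<^sup>2 * (t - s)) * expectation (\<lambda>\<omega>. W \<omega> * sin (l * gap s \<omega>))"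
\<comment> \<open>The constant is 16 from the Taylor remainder plus 2 from the meeting-time
  correction.\<close>
proof (rule exponential_decay_of_local_estimate[where C="18 * \<bar>l\<bar>^3", OF st(2)])
  fix r h assume r: "s \<le> r" "0 < h" "r + h \<le> t"
  have r0: "0 \<le> r" using r st by simp
  let ?f = "\<lambda>r. expectation (\<lambda>\<omega>. W \<omega> * sin (l * gap r \<omega>))"
  define f1 where "f1 \<omega> = W \<omega> * cos (l * gap r \<omega>)" for \<omega>
  define f2 where "f2 \<omega> = W \<omega> * sin (l * gap r \<omega>)" for \<omega>
  define d where "d \<omega> = gap (r + h) \<omega> - gap r \<omega>" for \<omega>
  have Wr: "W \<in> borel_measurable (F r)" by (rule measurable_filtration_mono[OF W r(1)])
  have [measurable]: "W \<in> borel_measurable M" by (rule measurable_filtration_imp[OF W])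
  have Zr: "gap r \<in> borel_measurable (F r)" using adapted_gap r0 by simp
  have fm: "f1 \<in> borel_measurable (F r)" "f2 \<in> borel_measurable (F r)"
    unfolding f1_def f2_def using Wr Zr by measurable
  have wb: "\<bar>W \<omega>\<bar> * \<bar>x\<bar> \<le> 1" if "\<bar>x\<bar> \<le> 1" for x \<omega>
    using mult_mono[OF W1[of \<omega>] that] by simp
  have fb: "\<bar>f1 \<omega>\<bar> \<le> 1" "\<bar>f2 \<omega>\<bar> \<le> 1" for \<omega>
    by (auto simp: f1_def f2_def abs_mult intro!: wb)
  note fM = fm[THEN measurable_filtration_imp]
  note [measurable] = fM
  have [measurable]: "d \<in> borel_measurable M"
    unfolding d_def using r0 r by (intro borel_measurable_diff measurable_gap) auto
  have bi: "integrable M g" if "g \<in> borel_measurable M" "\<And>\<omega>. \<bar>g \<omega>\<bar> \<le> 1" for g :: "'a \<Rightarrow> real"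
    using integrable_bounded_mult[OF integrable_const[of 1] that] by simp
  note mom = gap_increment_moments[OF r0 r(2), folded d_def]
  have di: "integrable M d" unfolding d_def using gap_integrable r0 r by simp
  have i1: "integrable M (\<lambda>\<omega>. f1 \<omega> * d \<omega>)"
    by (intro integrable_bounded_mult di fM fb)
  have "expectation (\<lambda>\<omega>. f1 \<omega> * d \<omega>) = expectation (\<lambda>\<omega>. f1 \<omega> * gap (r + h) \<omega>) - expectation (\<lambda>\<omega>. f1 \<omega> * gap r \<omega>)"
    unfolding d_def right_diff_distrib
    using r r0 by (intro Bochner_Integration.integral_diff integrable_bounded_mult gap_integrable fM fb) auto
  also have "\<dots> = 0"
    using gap_martingale_mult[OF r0 _ fm(1) fb(1), of "r + h"] r by simp
  finally have e1: "expectation (\<lambda>\<omega>. f1 \<omega> * d \<omega>) = 0" .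
  define a where "a = expectation (\<lambda>\<omega>. f2 \<omega> * (meet_time (r + h) \<omega> - meet_time r \<omega>))"
  have rh: "r \<le> r + h" using r by simp
  note sq = gap_increment_square_mult[OF r0 rh fm(2) fb(2), folded d_def a_def]
  have aest: "\<bar>a\<bar> \<le> 2 * \<bar>l\<bar> * (h * sqrt h)"
  proof -
    have "\<bar>a\<bar> \<le> expectation (\<lambda>\<omega>. \<bar>f2 \<omega> * (meet_time (r + h) \<omega> - meet_time r \<omega>)\<bar>)"
      unfolding a_def by (rule integral_abs_bound)
    \<comment> \<open>By absorption, \<open>meet_time\<close> can grow on \<open>[r, r + h]\<close> only if the gap vanishes at \<open>r + h\<close>, and then
      the sine at time \<open>r\<close> is at most \<open>\<bar>l\<bar> \<bar>d\<bar>\<close>; this is what makes the error of order \<open>h sqrt h\<close>.\<close>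
    also have "\<dots> \<le> expectation (\<lambda>\<omega>. \<bar>l\<bar> * h * \<bar>d \<omega>\<bar>)"
    proof (rule integral_mono_AE)
      have "AE \<omega> in M. \<forall>v\<in>{0..r+h}. gap v \<omega> = 0 \<longrightarrow> gap (r + h) \<omega> = 0"
        using gap_sticky[of "r + h"] r0 r by simp
      then show "AE \<omega> in M. \<bar>f2 \<omega> * (meet_time (r + h) \<omega> - meet_time r \<omega>)\<bar> \<le> \<bar>l\<bar> * h * \<bar>d \<omega>\<bar>"
      proof (rule AE_mp, intro AE_I2 impI)
        fix \<omega> assume \<omega>: "\<omega> \<in> space M" "\<forall>v\<in>{0..r+h}. gap v \<omega> = 0 \<longrightarrow> gap (r + h) \<omega> = 0"
        have dA: "\<bar>meet_time (r + h) \<omega> - meet_time r \<omega>\<bar> \<le> h * of_bool (gap (r + h) \<omega> = 0)"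
          using \<omega> r0 r by (intro meet_time_increment) auto
        show "\<bar>f2 \<omega> * (meet_time (r + h) \<omega> - meet_time r \<omega>)\<bar> \<le> \<bar>l\<bar> * h * \<bar>d \<omega>\<bar>"
        proof (cases "gap (r + h) \<omega> = 0")
          case True
          have "\<bar>f2 \<omega>\<bar> \<le> 1 * \<bar>l * gap r \<omega>\<bar>"
            unfolding f2_def abs_mult[of "W \<omega>"] using W1 by (intro mult_mono abs_sin_x_le_abs_x) auto
          also have "\<dots> = \<bar>l\<bar> * \<bar>d \<omega>\<bar>" using True by (simp add: d_def abs_mult)
          finally have "\<bar>f2 \<omega>\<bar> * \<bar>meet_time (r + h) \<omega> - meet_time r \<omega>\<bar> \<le> (\<bar>l\<bar> * \<bar>d \<omega>\<bar>) * h"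
            using dA True by (intro mult_mono) auto
          then show ?thesis by (simp add: abs_mult mult_ac)
        next
          case False
          then show ?thesis using dA r by (simp add: abs_mult)
        qed
      qed
    qed (use sq(2) mom(1) in auto)
    also have "\<dots> \<le> \<bar>l\<bar> * h * (2 * sqrt h)"
      using mom(2) r by (simp del: mult_le_cancel_left_pos add: mult_left_mono)
    finally show ?thesis by (simp add: mult_ac)
  qed
  have i2: "integrable M (\<lambda>\<omega>. W \<omega> * sin (l * gap (r + h) \<omega>))"
    using r r0 by (intro bi) (auto simp: abs_mult intro!: wb)
  have i3: "integrable M f2" by (intro bi fM fb)
  let ?R = "\<lambda>\<omega>. W \<omega> * sin (l * gap (r + h) \<omega>) - (f2 \<omega> + l * (f1 \<omega> * d \<omega>) - l\<^sup>2 / 2 * (f2 \<omega> * (d \<omega>)\<^sup>2))"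
  have iR: "integrable M ?R" using i1 i2 i3 sq(1) by simp
  have "\<bar>expectation ?R\<bar> \<le> expectation (\<lambda>\<omega>. \<bar>?R \<omega>\<bar>)" by (rule integral_abs_bound)
  also have "\<dots> \<le> expectation (\<lambda>\<omega>. \<bar>l\<bar>^3 * \<bar>d \<omega>\<bar>^3)"
  proof (rule integral_mono)
    fix \<omega>
    have "l * gap (r + h) \<omega> = l * gap r \<omega> + l * d \<omega>" by (simp add: d_def algebra_simps)
    then have "?R \<omega> = W \<omega> * (sin (l * gap r \<omega> + l * d \<omega>) - (sin (l * gap r \<omega>) + l * d \<omega> * cos (l * gap r \<omega>) - (l * d \<omega>)\<^sup>2 / 2 * sin (l * gap r \<omega>)))"
      by (simp add: f1_def f2_def power_mult_distrib algebra_simps)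
    also have "\<bar>\<dots>\<bar> \<le> 1 * \<bar>l * d \<omega>\<bar>^3"
      unfolding abs_mult[of "W \<omega>"] using W1 by (intro mult_mono sin_add_taylor2) auto
    finally show "\<bar>?R \<omega>\<bar> \<le> \<bar>l\<bar>^3 * \<bar>d \<omega>\<bar>^3" by (simp add: abs_mult power_mult_distrib)
  qed (use iR mom(3) in auto)
  also have "\<dots> \<le> \<bar>l\<bar>^3 * (16 * (h * sqrt h))"
    using mom(4) by (simp del: mult_le_cancel_left_pos add: mult_left_mono)
  finally have R: "\<bar>expectation ?R\<bar> \<le> 16 * \<bar>l\<bar>^3 * (h * sqrt h)" by (simp add: mult_ac)
  \<comment> \<open>The conditional bracket puts \<open>2 * h * ?f r - 2 * a\<close> in place of the
    second-order expectation; its factor 2 cancels the 1/2 of Taylor's formula and leaves the rate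
    \<open>l^2\<close>.\<close>
  have "expectation ?R = ?f (r + h) - (?f r + l * 0 - l\<^sup>2 / 2 * (2 * h * ?f r - 2 * a))"
  proof -
    have "?f r = expectation f2"
      by (rule Bochner_Integration.integral_cong) (auto simp: f2_def)
    then show ?thesis using i1 i2 i3 sq(1) by (simp add: e1 sq(3))
  qed
  then have "?f (r + h) - (1 - l\<^sup>2 * h) * ?f r = expectation ?R + l\<^sup>2 * a"
    by (simp add: algebra_simps)
  moreover have "\<bar>l\<^sup>2 * a\<bar> \<le> l\<^sup>2 * (2 * \<bar>l\<bar> * (h * sqrt h))"
    using aest by (simp add: abs_mult mult_left_mono)
  moreover have "l\<^sup>2 * (2 * \<bar>l\<bar> * (h * sqrt h)) = 2 * \<bar>l\<bar>^3 * (h * sqrt h)"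
  proof -
    have "p\<^sup>2 * (2 * p * x) = 2 * p^3 * x" for p x :: real by algebra
    from this[of "\<bar>l\<bar>" "h * sqrt h"] show ?thesis unfolding power2_abs .
  qed
  ultimately show "\<bar>?f (r + h) - (1 - l\<^sup>2 * h) * ?f r\<bar> \<le> 18 * \<bar>l\<bar>^3 * (h * sqrt h)"
    using R by linarith
qed auto

end

section \<open>Coalescence probabilities\<close>

text \<open>If \<open>g v < g u\<close> with \<open>u < v\<close>, right limits give rationals
  \<open>p\<close> just above \<open>u\<close>, still below \<open>v\<close>, and \<open>q\<close>
  just above \<open>v\<close> with \<open>g q < g p\<close>, although \<open>p < q\<close>.\<close>

lemma mono_of_mono_on_rats:
  fixes g :: "real \<Rightarrow> real"
  assumes right: "\<And>u. (g \<longlongrightarrow> g u) (at_right u)"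
    and rats: "\<And>p q. p \<in> \<rat> \<Longrightarrow> q \<in> \<rat> \<Longrightarrow> p \<le> q \<Longrightarrow> g p \<le> g q"
  shows "mono g"
proof (rule monoI, rule ccontr)
  fix u v :: real assume uv: "u \<le> v" and "\<not> g u \<le> g v"
  then have less: "g v < g u" "u < v" by (auto simp: less_le)
  define m where "m = (g u + g v) / 2"
  have m: "g v < m" "m < g u" using less by (auto simp: m_def)
  obtain a where a: "u < a" "\<And>x. u < x \<Longrightarrow> x < a \<Longrightarrow> m < g x"
    using order_tendstoD(1)[OF right m(2)] by (auto simp: eventually_at_right_field)
  obtain b where b: "v < b" "\<And>x. v < x \<Longrightarrow> x < b \<Longrightarrow> g x < m"
    using order_tendstoD(2)[OF right m(1)] by (auto simp: eventually_at_right_field)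
  obtain p where p: "p \<in> \<rat>" "u < p" "p < min a v" using Rats_dense_in_real[of u "min a v"] a(1) less(2) by auto
  obtain q where q: "q \<in> \<rat>" "v < q" "q < b" using Rats_dense_in_real[OF b(1)] by auto
  have "g p \<le> g q" using p q by (intro rats) auto
  moreover have "m < g p" "g q < m" using p q by (auto intro: a(2) b(2))
  ultimately show False by simp
qed

text \<open>The level set through 0 of a monotone function is an interval. Starting from the
  leftmost grid point \<open>- k * w\<close> on that level, failure of the claim confines the level
  set between \<open>- (k + 1) * w\<close> and \<open>(m - k) * w\<close>, an interval of length
  only \<open>(m + 1) * w\<close>.\<close>

lemma level_set_grid:
  fixes g :: "real \<Rightarrow> real" and m :: nat and w :: real
  assumes g: "mono g" and w: "0 < w"
    and big: "emeasure lebesgue {u. g 0 = g u} > ennreal ((real m + 1) * w)"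
  shows "\<exists>k\<le>m. g (- real k * w) = g ((real m - real k) * w)"
proof (rule ccontr)
  assume neg: "\<not> ?thesis"
  define P where "P k \<longleftrightarrow> k \<le> m \<and> g (- real k * w) = g 0" for k
  define k where "k = Greatest P"
  have P0: "P 0" and Pm: "\<And>j. P j \<Longrightarrow> j \<le> m" by (simp_all add: P_def)
  have k: "P k" "\<And>j. P j \<Longrightarrow> j \<le> k"
    unfolding k_def using P0 Pm GreatestI_nat[of P 0 m] Greatest_le_nat[of P _ m] by blast+
  have km: "k \<le> m" "g (- real k * w) = g 0" using k by (auto simp: P_def)
  have upper: "g ((real m - real k) * w) \<noteq> g 0" using neg km by auto
  \<comment> \<open>For \<open>k = m\<close> the right-hand grid point is 0 itself, which is on the
    level. Hence \<open>Suc k\<close> is still at most \<open>m\<close>, and maximality of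
    \<open>k\<close> applies to it.\<close>
  then have "k \<noteq> m" by auto
  then have "k < m" using km by simp
  then have lower: "g (- real (Suc k) * w) \<noteq> g 0" using k(2)[of "Suc k"] by (auto simp: P_def)
  have "{u. g 0 = g u} \<subseteq> {- real (Suc k) * w..(real m - real k) * w}"
  proof
    fix u assume "u \<in> {u. g 0 = g u}"
    then have u: "g u = g 0" by simp
    have "\<not> u < - real (Suc k) * w"
    proof
      assume "u < - real (Suc k) * w"
      moreover have "- real (Suc k) * w \<le> 0" using w by (intro mult_nonpos_nonneg) auto
      ultimately have "g (- real (Suc k) * w) = g 0"
        using u monoD[OF g, of u "- real (Suc k) * w"] monoD[OF g, of "- real (Suc k) * w" 0] by simp
      then show False using lower by simp
    qed
    moreover have "\<not> u > (real m - real k) * w"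
    proof
      assume "u > (real m - real k) * w"
      moreover have "(real m - real k) * w \<ge> 0" using w km by simp
      ultimately have "g ((real m - real k) * w) = g 0"
        using u monoD[OF g, of 0 "(real m - real k) * w"] monoD[OF g, of "(real m - real k) * w" u] by simp
      then show False using upper by simp
    qed
    ultimately show "u \<in> {- real (Suc k) * w..(real m - real k) * w}" by simp
  qed
  then have "emeasure lebesgue {u. g 0 = g u} \<le> emeasure lebesgue {- real (Suc k) * w..(real m - real k) * w}"
    by (intro emeasure_mono) auto
  also have "\<dots> = ennreal ((real m - real k) * w - (- real (Suc k) * w))"
  proof -
    have "- real (Suc k) * w \<le> 0" using w by (intro mult_nonpos_nonneg) auto
    also have "0 \<le> (real m - real k) * w" using w km by simp
    finally show ?thesis by simp
  qed
  also have "(real m - real k) * w - (- real (Suc k) * w) = (real m + 1) * w" by (simp add: algebra_simps)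
  finally show False using big by simp
qed

context arratia
begin

text \<open>The order axiom has an exceptional null set for each pair of starting points. Rational
  pairs need only countably many of them, and right continuity extends the order to all pairs on a
  single almost sure event.\<close>

lemma flow_mono_AE:
  assumes "right_continuous_version M y"
  shows "AE \<omega> in M. \<forall>t\<in>{0..1}. mono (\<lambda>u. y u t \<omega>)"
proof -
  have "AE \<omega> in M. \<forall>p\<in>\<rat>. \<forall>q\<in>\<rat>. p \<le> q \<longrightarrow> (\<forall>t\<ge>0. y p t \<omega> \<le> y q t \<omega>)"
  proof (intro AE_ball_countable[THEN iffD2] ballI countable_rat)
    show "AE \<omega> in M. p \<le> q \<longrightarrow> (\<forall>t\<ge>0. y p t \<omega> \<le> y q t \<omega>)" for p q
      using ordered[of p q] by (cases "p \<le> q") simp_all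
  qed
  moreover have "AE \<omega> in M. \<forall>u. uniform_limit {0..1} (\<lambda>v t. y v t \<omega>) (\<lambda>t. y u t \<omega>) (at_right u)"
    using assms unfolding right_continuous_version_def .
  ultimately show ?thesis
  proof eventually_elim
    case (elim \<omega>)
    show ?case
    proof (intro ballI mono_of_mono_on_rats)
      fix t u :: real assume "t \<in> {0..1}"
      then show "((\<lambda>u. y u t \<omega>) \<longlongrightarrow> y u t \<omega>) (at_right u)"
        by (intro tendsto_uniform_limitI[OF elim(2)[rule_format]])
    qed (simp add: elim(1))
  qed
qed

end

section \<open>The exact conditional law of coalescence\<close>

context arratia_pair
begin

text \<open>An independent standard normal variable is adjoined as a second coordinate. Averaging
  over it multiplies \<open>sin (l * gap s)\<close> by \<open>exp (- l^2 * (t - s))\<close>, the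
  factor in \<open>sine_transform_decay\<close>, so the two sides have the same sine transform for
  every \<open>l\<close>.\<close>

lemma expectation_sgn_gap:
  assumes st: "0 \<le> s" "s < t" and B: "B \<in> sets (F s)"
  defines "\<sigma> \<equiv> sqrt (2 * (t - s))"
  shows "expectation (\<lambda>\<omega>. indicator B \<omega> * sgn (gap t \<omega>)) =
    (LINT q|(M \<Otimes>\<^sub>M std_normal_distribution). indicator B (fst q) * sgn (gap s (fst q) + \<sigma> * snd q))"
proof -
  interpret N: real_distribution std_normal_distribution by (rule real_dist_normal_dist)
  interpret Q: pair_prob_space M std_normal_distribution ..
  let ?Q = "M \<Otimes>\<^sub>M std_normal_distribution"
  have BM[measurable]: "B \<in> sets M" by (rule sets_filtration_subset[OF B])
  have [measurable]: "gap s \<in> borel_measurable M" "gap t \<in> borel_measurable M" using st by auto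
  have "integrable std_normal_distribution (\<lambda>x. x)"
    using integrable_std_normal_distribution_moment[of 1] by simp
  moreover have "integrable ?Q (\<lambda>q. gap s (fst q))" "integrable ?Q snd"
    if "integrable std_normal_distribution (\<lambda>x. x)"
  proof -
    show "integrable ?Q (\<lambda>q. gap s (fst q))"
      using gap_integrable[OF st(1)] by (intro Q.Fubini_integrable) simp_all
    show "integrable ?Q snd"
      using that by (intro Q.Fubini_integrable) simp_all
  qed
  ultimately have iV: "integrable ?Q (\<lambda>q. gap s (fst q) + \<sigma> * snd q)" by auto
  have eq: "expectation (\<lambda>\<omega>. indicator B \<omega> * sin (l * gap t \<omega>)) =
    (LINT q|?Q. indicator B (fst q) * sin (l * (gap s (fst q) + \<sigma> * snd q)))" for l
  proof -
    have "\<sigma>\<^sup>2 = 2 * (t - s)" using st by (simp add: \<sigma>_def)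
    then have exp_eq: "- (l * \<sigma>)\<^sup>2 / 2 = - l\<^sup>2 * (t - s)"
      by (simp add: power_mult_distrib)
    have bounded: "integrable ?Q (\<lambda>q. indicator B (fst q) * sin (l * (gap s (fst q) + \<sigma> * snd q)))"
      by (rule Q.integrable_const_bound[where B=1]) (auto simp: indicator_def)
    have "(LINT q|?Q. indicator B (fst q) * sin (l * (gap s (fst q) + \<sigma> * snd q))) =
      expectation (\<lambda>\<omega>. LINT x|std_normal_distribution. indicator B \<omega> * sin (l * (gap s \<omega> + \<sigma> * x)))"
      using Q.integral_fst'[OF bounded] by simp
    also have "\<dots> = expectation (\<lambda>\<omega>. exp (- l\<^sup>2 * (t - s)) * (indicator B \<omega> * sin (l * gap s \<omega>)))"
    proof (rule Bochner_Integration.integral_cong[OF refl])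
      fix \<omega>
      have i: "integrable std_normal_distribution (\<lambda>x. cos ((l * \<sigma>) * x))"
        "integrable std_normal_distribution (\<lambda>x. sin ((l * \<sigma>) * x))"
        by (auto intro!: N.integrable_const_bound[where B=1])
      have "(LINT x|std_normal_distribution. indicator B \<omega> * sin (l * (gap s \<omega> + \<sigma> * x))) =
        (LINT x|std_normal_distribution. (indicator B \<omega> * sin (l * gap s \<omega>)) * cos ((l * \<sigma>) * x)
          + (indicator B \<omega> * cos (l * gap s \<omega>)) * sin ((l * \<sigma>) * x))"
        by (intro Bochner_Integration.integral_cong refl) (simp add: sin_add distrib_left mult.assoc)
      also have "\<dots> = (indicator B \<omega> * sin (l * gap s \<omega>)) * exp (- (l * \<sigma>)\<^sup>2 / 2)"
        unfolding Bochner_Integration.integral_add[OF integrable_mult_right[OF i(1)] integrable_mult_right[OF i(2)]]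
          integral_mult_right_zero std_normal_sin_cos by simp
      finally show "(LINT x|std_normal_distribution. indicator B \<omega> * sin (l * (gap s \<omega> + \<sigma> * x))) =
        exp (- l\<^sup>2 * (t - s)) * (indicator B \<omega> * sin (l * gap s \<omega>))"
        unfolding exp_eq by (simp add: mult.commute)
    qed
    also have "\<dots> = expectation (\<lambda>\<omega>. indicator B \<omega> * sin (l * gap t \<omega>))"
    proof -
      have "(indicator B :: 'a \<Rightarrow> real) \<in> borel_measurable (F s)" "\<bar>indicator B \<omega> :: real\<bar> \<le> 1" for \<omega>
        using B by (simp_all add: indicator_def)
      from sine_transform_decay[OF st this, of l] show ?thesis by simp
    qed
    finally show ?thesis by simp
  qed
  \<comment> \<open>By \<open>eq\<close> the truncated transforms on the two probability spaces form
    one and the same sequence, so its two limits agree.\<close>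
  have "pi / 2 * expectation (\<lambda>\<omega>. indicator B \<omega> * sgn (gap t \<omega>)) =
    pi / 2 * (LINT q|?Q. indicator B (fst q) * sgn (gap s (fst q) + \<sigma> * snd q))"
  proof (rule LIMSEQ_unique)
    show "(\<lambda>n::nat. LBINT l. indicator {0<..<real n} l * (expectation (\<lambda>\<omega>. indicator B \<omega> * sin (l * gap t \<omega>)) / l))
      \<longlonglongrightarrow> pi / 2 * expectation (\<lambda>\<omega>. indicator B \<omega> * sgn (gap t \<omega>))"
      using st by (intro sine_transform_tendsto_sgn gap_integrable) (auto simp: indicator_def)
    show "(\<lambda>n::nat. LBINT l. indicator {0<..<real n} l * (expectation (\<lambda>\<omega>. indicator B \<omega> * sin (l * gap t \<omega>)) / l))
      \<longlonglongrightarrow> pi / 2 * (LINT q|?Q. indicator B (fst q) * sgn (gap s (fst q) + \<sigma> * snd q))"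
      unfolding eq by (intro Q.sine_transform_tendsto_sgn iV) (auto simp: indicator_def)
  qed
  then show ?thesis by simp
qed

text \<open>As the gap is almost surely nonnegative, its sign is the indicator of not having
  met.\<close>

lemma prob_not_met:
  assumes st: "0 \<le> s" "s < t" and B: "B \<in> sets (F s)"
  shows "prob {\<omega> \<in> B. gap t \<omega> \<noteq> 0} = (LINT q|(M \<Otimes>\<^sub>M std_normal_distribution).
    indicator B (fst q) * sgn (gap s (fst q) + sqrt (2 * (t - s)) * snd q))"
proof -
  have BM[measurable]: "B \<in> sets M" by (rule sets_filtration_subset[OF B])
  have [measurable]: "gap t \<in> borel_measurable M" using st by auto
  have "{\<omega> \<in> B. gap t \<omega> \<noteq> 0} = {\<omega> \<in> space M. \<omega> \<in> B \<and> gap t \<omega> \<noteq> 0}"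
    using sets.sets_into_space[OF BM] by auto
  then have S[measurable]: "{\<omega> \<in> B. gap t \<omega> \<noteq> 0} \<in> sets M" by simp
  have "prob {\<omega> \<in> B. gap t \<omega> \<noteq> 0} = expectation (indicator {\<omega> \<in> B. gap t \<omega> \<noteq> 0})" by simp
  also have "\<dots> = expectation (\<lambda>\<omega>. indicator B \<omega> * sgn (gap t \<omega>))"
  proof (rule integral_cong_AE)
    show "AE \<omega> in M. indicator {\<omega> \<in> B. gap t \<omega> \<noteq> 0} \<omega> = indicator B \<omega> * sgn (gap t \<omega>)"
      using gap_nonneg
    proof eventually_elim
      case (elim \<omega>)
      then have "0 \<le> gap t \<omega>" using st by auto
      then show ?case by (auto simp: indicator_def sgn_if)
    qed
  qed auto
  also have "\<dots> = (LINT q|(M \<Otimes>\<^sub>M std_normal_distribution).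
      indicator B (fst q) * sgn (gap s (fst q) + sqrt (2 * (t - s)) * snd q))"
    by (rule expectation_sgn_gap[OF st B])
  finally show ?thesis .
qed

text \<open>The sign function is monotone, so on \<open>B\<close> the random gap at time
  \<open>s\<close> may be replaced by its bound \<open>d\<close>; the normal coordinate is then
  integrated out on its own.\<close>

lemma prob_not_met_le:
  assumes st: "0 \<le> s" "s < t" and B: "B \<in> sets (F s)" and d: "\<And>\<omega>. \<omega> \<in> B \<Longrightarrow> gap s \<omega> \<le> d"
  shows "prob {\<omega> \<in> B. gap t \<omega> \<noteq> 0} \<le> prob B * (1 - 2 * std_normal_tail (d / sqrt (2 * (t - s))))"
proof -
  interpret N: real_distribution std_normal_distribution by (rule real_dist_normal_dist)
  interpret Q: pair_prob_space M std_normal_distribution ..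
  let ?Q = "M \<Otimes>\<^sub>M std_normal_distribution"
  define \<sigma> where "\<sigma> = sqrt (2 * (t - s))"
  have \<sigma>: "0 < \<sigma>" using st by (simp add: \<sigma>_def)
  have BM[measurable]: "B \<in> sets M" by (rule sets_filtration_subset[OF B])
  have [measurable]: "gap s \<in> borel_measurable M" using st by auto
  have "prob {\<omega> \<in> B. gap t \<omega> \<noteq> 0} = (LINT q|?Q. indicator B (fst q) * sgn (gap s (fst q) + \<sigma> * snd q))"
    unfolding \<sigma>_def by (rule prob_not_met[OF st B])
  also have "\<dots> \<le> (LINT q|?Q. indicator B (fst q) * sgn (d + \<sigma> * snd q))"
  proof (rule integral_mono)
    show "integrable ?Q (\<lambda>q. indicator B (fst q) * sgn (gap s (fst q) + \<sigma> * snd q))"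
      by (rule Q.integrable_const_bound[where B=1]) (auto simp: indicator_def abs_sgn_eq)
    show i: "integrable ?Q (\<lambda>q. indicator B (fst q) * sgn (d + \<sigma> * snd q))"
      by (rule Q.integrable_const_bound[where B=1]) (auto simp: indicator_def abs_sgn_eq)
    fix q
    show "indicator B (fst q) * sgn (gap s (fst q) + \<sigma> * snd q) \<le> indicator B (fst q) * sgn (d + \<sigma> * snd q)"
    proof (cases "fst q \<in> B")
      case True
      then have "gap s (fst q) + \<sigma> * snd q \<le> d + \<sigma> * snd q" using d by simp
      then show ?thesis by (auto simp: sgn_if)
    qed simp
  qed
  also have "\<dots> = expectation (\<lambda>\<omega>. LINT x|std_normal_distribution. indicator B \<omega> * sgn (d + \<sigma> * x))"
  proof -
    have "integrable ?Q (\<lambda>q. indicator B (fst q) * sgn (d + \<sigma> * snd q))"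
      by (rule Q.integrable_const_bound[where B=1]) (auto simp: indicator_def abs_sgn_eq)
    from Q.integral_fst'[OF this] show ?thesis by simp
  qed
  also have "\<dots> = prob B * (1 - 2 * std_normal_tail (d / \<sigma>))"
    by (simp add: std_normal_sgn[OF \<sigma>])
  finally show ?thesis by (simp add: \<sigma>_def)
qed

text \<open>Taken from time 0, where the gap is deterministic, the formula is exact: the probability
  is twice a normal tail at \<open>(u2 - u1) / sqrt (2 * t)\<close>.\<close>

lemma prob_met_le:
  assumes t: "0 < t"
  shows "prob {\<omega> \<in> space M. gap t \<omega> = 0} \<le> 2 * exp (- (u2 - u1)\<^sup>2 / (4 * t))"
proof -
  interpret N: real_distribution std_normal_distribution by (rule real_dist_normal_dist)
  interpret Q: pair_prob_space M std_normal_distribution ..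
  let ?Q = "M \<Otimes>\<^sub>M std_normal_distribution"
  define \<sigma> where "\<sigma> = sqrt (2 * t)"
  have \<sigma>: "0 < \<sigma>" using t by (simp add: \<sigma>_def)
  have [measurable]: "gap t \<in> borel_measurable M" using t by auto
  have sp: "space M \<in> sets (F 0)" using sets.top[of "F 0"] by simp
  have "1 - prob {\<omega> \<in> space M. gap t \<omega> = 0} = prob {\<omega> \<in> space M. gap t \<omega> \<noteq> 0}"
    by (subst prob_neg) auto
  also have "\<dots> = (LINT q|?Q. indicator (space M) (fst q) * sgn (gap 0 (fst q) + \<sigma> * snd q))"
    using prob_not_met[OF _ t sp] by (simp add: \<sigma>_def)
  also have "\<dots> = (LINT q|?Q. sgn ((u2 - u1) + \<sigma> * snd q))"
    by (intro Bochner_Integration.integral_cong refl) (auto simp: space_pair_measure gap_0)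
  also have "\<dots> = expectation (\<lambda>\<omega>. LINT x|std_normal_distribution. sgn ((u2 - u1) + \<sigma> * x))"
  proof -
    have "integrable ?Q (\<lambda>q. sgn ((u2 - u1) + \<sigma> * snd q))"
      by (rule Q.integrable_const_bound[where B=1]) (auto simp: abs_sgn_eq)
    from Q.integral_fst'[OF this] show ?thesis by simp
  qed
  also have "\<dots> = 1 - 2 * std_normal_tail ((u2 - u1) / \<sigma>)"
    by (simp add: std_normal_sgn[OF \<sigma>] prob_space)
  finally have "prob {\<omega> \<in> space M. gap t \<omega> = 0} = 2 * std_normal_tail ((u2 - u1) / \<sigma>)" by simp
  also have "\<dots> \<le> 2 * exp (- ((u2 - u1) / \<sigma>)\<^sup>2 / 2)"
    using std_normal_tail_le[of "(u2 - u1) / \<sigma>"] \<sigma> u12 by simp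
  also have "- ((u2 - u1) / \<sigma>)\<^sup>2 / 2 = - (u2 - u1)\<^sup>2 / (4 * t)"
    using t by (simp add: \<sigma>_def power_divide)
  finally show ?thesis .
qed

end

section \<open>The upper bound\<close>

lemma (in arratia) prob_equal_le:
  assumes "u1 \<le> u2" "0 < t"
  shows "prob {\<omega> \<in> space M. y u1 t \<omega> = y u2 t \<omega>} \<le> 2 * exp (- (u2 - u1)\<^sup>2 / (4 * t))"
proof -
  interpret arratia_pair M y u1 u2 by unfold_locales (rule assms(1))
  have eq: "y u1 v \<omega> = y u2 v \<omega> \<longleftrightarrow> gap v \<omega> = 0" for v \<omega>
    unfolding gap_def by linarith
  show ?thesis unfolding eq by (rule prob_met_le[OF assms(2)])
qed

lemma (in arratia) equal_sticky:
  assumes "u1 \<le> u2" "0 \<le> t"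
  shows "AE \<omega> in M. \<forall>v\<in>{0..t}. y u1 v \<omega> = y u2 v \<omega> \<longrightarrow> y u1 t \<omega> = y u2 t \<omega>"
proof -
  interpret arratia_pair M y u1 u2 by unfold_locales (rule assms(1))
  have eq: "y u1 v \<omega> = y u2 v \<omega> \<longleftrightarrow> gap v \<omega> = 0" for v \<omega>
    unfolding gap_def by linarith
  show ?thesis unfolding eq by (rule gap_sticky[OF assms(2)])
qed

lemma geometric_bracket:
  fixes q t :: real
  assumes q: "0 < q" "q < 1" and t: "0 < t" "t \<le> q ^ n0"
  obtains n where "n0 \<le> n" "q ^ Suc n < t" "t \<le> q ^ n"
proof -
  define N where "N = (LEAST N. q ^ N < t)"
  obtain N' where "q ^ N' < t" using real_arch_pow_inv[OF t(1) q(2)] by auto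
  then have N: "q ^ N < t" unfolding N_def by (rule LeastI)
  have "n0 < N"
  proof (rule ccontr)
    assume "\<not> n0 < N"
    then have "q ^ n0 \<le> q ^ N" using q by (intro power_decreasing) auto
    then show False using N t by simp
  qed
  then obtain n where n: "N = Suc n" "n0 \<le> n" by (cases N) auto
  have "\<not> q ^ n < t" using not_less_Least[of n "\<lambda>N. q ^ N < t"] n(1) unfolding N_def by simp
  then show thesis using that[of n] n N by simp
qed

text \<open>The same ratio \<open>q = m / (m + 1)\<close> serves as grid loss and as time ratio. Two
  factors \<open>q\<close> come from the squared distance \<open>m * w n = q * x n\<close>, and the
  third from using \<open>q ^ Suc n\<close> in place of \<open>q ^ n\<close>.\<close>

lemma exists_ratio_cube:
  fixes c :: real
  assumes "1 < c"
  obtains m :: nat where "0 < m" "1 < c\<^sup>2 * (real m / (real m + 1)) ^ 3"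
proof -
  have "((\<lambda>m::nat. c\<^sup>2 * (real m / (real m + 1)) ^ 3) \<longlongrightarrow> c\<^sup>2 * 1 ^ 3) sequentially"
    by (intro tendsto_intros) real_asymp
  moreover have "1 < c\<^sup>2 * 1 ^ 3" using assms by (simp add: one_less_power)
  ultimately have "eventually (\<lambda>m::nat. 1 < c\<^sup>2 * (real m / (real m + 1)) ^ 3) sequentially"
    by (rule order_tendstoD)
  then have "eventually (\<lambda>m. (0::nat) < m \<and> 1 < c\<^sup>2 * (real m / (real m + 1)) ^ 3) sequentially"
    using eventually_gt_at_top[of 0] by eventually_elim simp
  then have "\<exists>m. (0::nat) < m \<and> 1 < c\<^sup>2 * (real m / (real m + 1)) ^ 3"
    by (rule eventually_happens'[OF sequentially_bot])
  then obtain m :: nat where "0 < m \<and> 1 < c\<^sup>2 * (real m / (real m + 1)) ^ 3" ..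
  then show thesis using that[of m] by blast
qed

text \<open>If the cluster at some \<open>t\<close> in the block from \<open>q ^ Suc n\<close> to
  \<open>q ^ n\<close> exceeds \<open>x n\<close>, two grid points at distance
  \<open>m * w n\<close> have met by \<open>t\<close>, hence by \<open>q ^ n\<close>, which is the
  event \<open>E n\<close>. Its probability is of order \<open>n powr (- \<kappa>)\<close> with
  \<open>\<kappa> > 1\<close>, so Borel-Cantelli applies.\<close>

lemma (in arratia) cluster_upper:
  assumes rc: "right_continuous_version M y" and c: "1 < c"
  shows "AE \<omega> in M. eventually (\<lambda>t. cluster_size y t \<omega> \<le> ennreal (c * (2 * sqrt (t * ln (ln (1 / t)))))) (at_right 0)"
proof -
  obtain m :: nat where m: "0 < m" "1 < c\<^sup>2 * (real m / (real m + 1)) ^ 3" by (rule exists_ratio_cube[OF c])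
  define q :: real where "q = real m / (real m + 1)"
  define \<kappa> where "\<kappa> = c\<^sup>2 * q ^ 3"
  define L where "L = ln (1 / q)"
  have q: "0 < q" "q < 1" using m by (auto simp: q_def)
  have L: "0 < L" using q by (simp add: L_def)
  have \<kappa>: "1 < \<kappa>" using m by (simp add: \<kappa>_def q_def)
  \<comment> \<open>A lower bound for the target on the whole block: \<open>q ^ Suc n\<close> is
    below \<open>t\<close>, and \<open>n * L = ln (1 / q ^ n)\<close> is at most
    \<open>ln (1 / t)\<close>.\<close>
  define x where "x n = c * (2 * sqrt (q ^ Suc n * ln (n * L)))" for n :: nat
  define w where "w n = x n / (real m + 1)" for n
  define E where "E n = (\<Union>k\<in>{..m}. {\<omega> \<in> space M. y (- real k * w n) (q ^ n) \<omega> = y ((real m - real k) * w n) (q ^ n) \<omega>})" for n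
  \<comment> \<open>From \<open>n0\<close> on the iterated logarithm is positive.\<close>
  obtain n0 :: nat where "1 / L < n0" using reals_Archimedean2 by blast
  then have nL: "1 < n * L" if "n0 \<le> n" for n
  proof -
    have "1 / L < n" using \<open>1 / L < n0\<close> that by simp
    then show ?thesis using L by (simp add: field_simps)
  qed
  have x: "0 < x n" if "n0 \<le> n" for n
    using nL[OF that] q c by (simp add: x_def)
  have w: "0 < w n" if "n0 \<le> n" for n using x[OF that] by (simp add: w_def)
  have [measurable]: "E n \<in> sets M" for n
    unfolding E_def using q measurable_flow[of "q ^ n"] by (intro sets.finite_UN) auto
  have E_prob: "prob (E n) \<le> (real m + 1) * 2 * L powr (- \<kappa>) * n powr (- \<kappa>)" if n: "n0 \<le> n" for n
  proof -
    have "prob (E n) \<le> (\<Sum>k\<le>m. prob {\<omega> \<in> space M. y (- real k * w n) (q ^ n) \<omega> = y ((real m - real k) * w n) (q ^ n) \<omega>})"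
      unfolding E_def using q measurable_flow[of "q ^ n"] by (intro finite_measure_subadditive_finite) auto
    also have "\<dots> \<le> (\<Sum>k\<le>m. 2 * (n * L) powr (- \<kappa>))"
    proof (rule sum_mono)
      fix k assume k: "k \<in> {..m}"
      have "(m * w n)\<^sup>2 / (4 * q ^ n) = \<kappa> * ln (n * L)"
      proof -
        have mw: "m * w n = q * x n" by (simp add: q_def w_def)
        have x2: "(x n)\<^sup>2 = c\<^sup>2 * 4 * (q ^ Suc n * ln (n * L))"
          using nL[OF n] q by (simp add: x_def power_mult_distrib)
        show ?thesis
          unfolding mw power_mult_distrib x2 using q
          by (simp add: \<kappa>_def power2_eq_square power3_eq_cube)
      qed
      then have "exp (- ((real m - real k) * w n - (- real k * w n))\<^sup>2 / (4 * q ^ n)) = exp (- \<kappa> * ln (n * L))"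
        by (simp add: algebra_simps)
      also have "\<dots> = (n * L) powr (- \<kappa>)"
        using nL[OF n] by (cases "n = 0") (auto simp: powr_def)
      finally have "2 * exp (- ((real m - real k) * w n - (- real k * w n))\<^sup>2 / (4 * q ^ n)) = 2 * (n * L) powr (- \<kappa>)" by simp
      moreover have "- real k * w n \<le> (real m - real k) * w n"
        using w[OF n] by (intro mult_right_mono) auto
      ultimately show "prob {\<omega> \<in> space M. y (- real k * w n) (q ^ n) \<omega> = y ((real m - real k) * w n) (q ^ n) \<omega>}
          \<le> 2 * (n * L) powr (- \<kappa>)"
        using prob_equal_le[of "- real k * w n" "(real m - real k) * w n" "q ^ n"] q by simp
    qed
    also have "\<dots> = (real m + 1) * 2 * L powr (- \<kappa>) * n powr (- \<kappa>)"
      using L by (simp add: powr_mult)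
    finally show ?thesis .
  qed
  have "summable (\<lambda>n. prob (E n))"
  proof (rule summable_comparison_test_ev)
    show "summable (\<lambda>n::nat. (real m + 1) * 2 * L powr (- \<kappa>) * n powr (- \<kappa>))"
      using \<kappa> by (intro summable_mult) (simp add: summable_real_powr_iff)
    show "eventually (\<lambda>n. norm (prob (E n)) \<le> (real m + 1) * 2 * L powr (- \<kappa>) * n powr (- \<kappa>)) sequentially"
      using eventually_ge_at_top[of n0]
    proof eventually_elim
      case (elim n)
      show ?case using E_prob[OF elim] by (simp only: real_norm_def abs_of_nonneg measure_nonneg)
    qed
  qed
  then have "AE \<omega> in M. eventually (\<lambda>n. \<omega> \<in> space M - E n) sequentially"
    by (intro borel_cantelli_AE1) (auto simp: less_top[symmetric])
  \<comment> \<open>Absorption carries a meeting at any time of the block to its right end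
    \<open>q ^ n\<close>. Only countably many pairs of grid points occur, so one null set
    suffices.\<close>
  moreover have "AE \<omega> in M. \<forall>n\<in>{n0..}. \<forall>k\<in>{..m}. \<forall>v\<in>{0..q ^ n}.
      y (- real k * w n) v \<omega> = y ((real m - real k) * w n) v \<omega> \<longrightarrow>
      y (- real k * w n) (q ^ n) \<omega> = y ((real m - real k) * w n) (q ^ n) \<omega>"
  proof (rule AE_ball_countable[THEN iffD2, rule_format], simp, rule AE_ball_countable[THEN iffD2, rule_format], simp)
    fix n k assume nk: "n \<in> {n0..}" "k \<in> {..m}"
    show "AE \<omega> in M. \<forall>v\<in>{0..q ^ n}.
      y (- real k * w n) v \<omega> = y ((real m - real k) * w n) v \<omega> \<longrightarrow>
      y (- real k * w n) (q ^ n) \<omega> = y ((real m - real k) * w n) (q ^ n) \<omega>"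
      using nk q w[of n] by (intro equal_sticky mult_right_mono) auto
  qed
  ultimately show ?thesis
    using flow_mono_AE[OF rc] AE_space
  proof eventually_elim
    case (elim \<omega>)
    obtain n1 where n1: "\<And>n. n1 \<le> n \<Longrightarrow> \<omega> \<notin> E n"
      using elim(1) by (auto simp: eventually_sequentially)
    define n2 where "n2 = max n0 n1"
    have small: "cluster_size y t \<omega> \<le> ennreal (c * (2 * sqrt (t * ln (ln (1 / t)))))"
      if t: "0 < t" "t \<le> q ^ n2" for t
    proof -
      obtain n where n: "n2 \<le> n" "q ^ Suc n < t" "t \<le> q ^ n"
        by (rule geometric_bracket[OF q t])
      have n0: "n0 \<le> n" and "n1 \<le> n" using n by (auto simp: n2_def)
      have t1: "t \<le> 1" using n(3) power_le_one[of q n] q by simp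
      have "n * L = ln (1 / q ^ n)" using q by (simp add: L_def ln_div ln_realpow)
      also have "\<dots> \<le> ln (1 / t)" using n(3) t q by (simp add: frac_le)
      finally have lL: "n * L \<le> ln (1 / t)" .
      have "ln (n * L) \<le> ln (ln (1 / t))" using lL nL[OF n0] by simp
      moreover have "0 < ln (n * L)" using nL[OF n0] by simp
      ultimately have "x n \<le> c * (2 * sqrt (t * ln (ln (1 / t))))"
        unfolding x_def using n(2) c q t
        by (intro mult_left_mono real_sqrt_le_mono mult_mono) auto
      moreover have "cluster_size y t \<omega> \<le> ennreal (x n)"
      proof (rule ccontr)
        assume "\<not> ?thesis"
        then have "emeasure lebesgue {u. y 0 t \<omega> = y u t \<omega>} > ennreal ((real m + 1) * w n)"
          by (simp add: cluster_size_def w_def)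
        moreover have "mono (\<lambda>u. y u t \<omega>)" using elim(3) t t1 by auto
        ultimately obtain k where k: "k \<le> m" "y (- real k * w n) t \<omega> = y ((real m - real k) * w n) t \<omega>"
          using level_set_grid[of "\<lambda>u. y u t \<omega>" "w n" m] w[OF n0] by auto
        then have "y (- real k * w n) (q ^ n) \<omega> = y ((real m - real k) * w n) (q ^ n) \<omega>"
          using elim(2)[rule_format, of n k t] k(1) n0 n(3) t by simp
        then have "\<omega> \<in> E n" using k elim(4) by (auto simp: E_def)
        then show False using n1 \<open>n1 \<le> n\<close> by auto
      qed
      ultimately show ?thesis by (meson ennreal_leI order_trans)
    qed
    have "0 < q ^ n2" using q by simp
    then show ?case
      unfolding eventually_at_right_field using small by (intro exI[of _ "q ^ n2"]) auto
  qed
qed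

section \<open>The lower bound\<close>

text \<open>With \<open>s = sqrt (2 * ln k)\<close> the argument is at most \<open>b' * s\<close>
  for some \<open>b' < 1\<close>, so the exponent in the tail bound exceeds \<open>- ln k\<close> by
  at least 1. The gained factor \<open>exp 1\<close> pays for \<open>sqrt (2 * pi)\<close>.\<close>

lemma eventually_std_normal_tail_ge_inverse:
  fixes b :: real
  assumes b: "0 < b" "b < 1"
  shows "eventually (\<lambda>k::nat. 1 / k \<le> 2 * std_normal_tail (b * sqrt (2 * ln k) / sqrt (1 - exp (- (2 * real k + 1))))) sequentially"
proof -
  \<comment> \<open>Room between \<open>b\<close> and 1 for the factor
    \<open>sqrt (1 - exp (- (2 * real k + 1)))\<close>, which tends to 1.\<close>
  define b' where "b' = (b + 1) / 2"
  have b': "0 < b'" "b < b'" "b' < 1" using b by (auto simp: b'_def)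
  then have b2: "b'\<^sup>2 < 1" using power_strict_mono[of b' 1 2] by simp
  have "(\<lambda>k::nat. b / sqrt (1 - exp (- (2 * real k + 1)))) \<longlonglongrightarrow> b / sqrt (1 - 0)"
    by (intro tendsto_intros) (real_asymp | simp)+
  then have "eventually (\<lambda>k::nat. b / sqrt (1 - exp (- (2 * real k + 1))) < b') sequentially"
    using b'(2) by (intro order_tendstoD) auto
  moreover have "filterlim (\<lambda>k::nat. sqrt (2 * ln (real k))) at_top sequentially" by real_asymp
  \<comment> \<open>The threshold makes \<open>s^2 * (1 - b'^2)\<close> at least
    \<open>5 * s\<close>; with \<open>s \<ge> 1\<close> this outweighs the terms
    \<open>2 * b' * s + 1\<close> of the expanded square and leaves a surplus of 2.\<close>
  then have "eventually (\<lambda>k::nat. max 1 (5 / (1 - b'\<^sup>2)) \<le> sqrt (2 * ln (real k))) sequentially"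
    unfolding filterlim_at_top by (rule spec)
  ultimately show ?thesis
    using eventually_gt_at_top[of 0]
  proof eventually_elim
    case (elim k)
    define s where "s = sqrt (2 * ln (real k))"
    define a where "a = b * s / sqrt (1 - exp (- (2 * real k + 1)))"
    have "1 \<le> s" "5 / (1 - b'\<^sup>2) \<le> s" using elim(2) unfolding s_def by linarith+
    then have s: "1 \<le> s" "5 \<le> s * (1 - b'\<^sup>2)" using b2 by (simp_all add: pos_divide_le_eq)
    have s2: "s\<^sup>2 / 2 = ln k" using elim(3) by (simp add: s_def)
    have a0: "0 \<le> a" using b s by (simp add: a_def)
    have "a = (b / sqrt (1 - exp (- (2 * real k + 1)))) * s" by (simp add: a_def)
    also have "\<dots> \<le> b' * s" using elim(1) s by (intro mult_right_mono) auto
    finally have a: "a \<le> b' * s" .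
    have "(a + 1)\<^sup>2 \<le> (b' * s + 1)\<^sup>2" using a a0 by (intro power_mono) auto
    also have "\<dots> = s\<^sup>2 - s * (s * (1 - b'\<^sup>2)) + 2 * (b' * s) + 1" by (simp add: power2_eq_square algebra_simps)
    also have "\<dots> \<le> s\<^sup>2 - s * 5 + 2 * (1 * s) + 1"
      using s b' by (intro add_mono diff_mono mult_mono) auto
    also have "\<dots> \<le> s\<^sup>2 - 2" using s by simp
    finally have "- (a + 1)\<^sup>2 / 2 \<ge> 1 - ln k" using s2 by simp
    then have "exp (1 - ln k) \<le> exp (- (a + 1)\<^sup>2 / 2)" by simp
    then have e: "exp 1 / k \<le> exp (- (a + 1)\<^sup>2 / 2)" using elim(3) by (simp add: exp_diff)
    have "sqrt (2 * pi) \<le> sqrt (3\<^sup>2)" using pi_less_4 by (intro real_sqrt_le_mono) simp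
    then have "sqrt (2 * pi) \<le> 3" by simp
    moreover have "2 \<le> exp (1::real)" using exp_ge_add_one_self[of 1] by simp
    ultimately have "1 \<le> 2 * (exp 1 / sqrt (2 * pi))" by (simp add: field_simps)
    then have "1 / k \<le> 2 * (exp 1 / sqrt (2 * pi)) / k" using elim(3) by (intro divide_right_mono) auto
    also have "\<dots> = 2 * ((exp 1 / k) / sqrt (2 * pi))" by simp
    also have "\<dots> \<le> 2 * (exp (- (a + 1)\<^sup>2 / 2) / sqrt (2 * pi))"
      using e by (intro mult_left_mono divide_right_mono) auto
    also have "\<dots> \<le> 2 * std_normal_tail a"
      using std_normal_tail_ge[OF a0] by simp
    finally show ?case by (simp add: a_def s_def)
  qed
qed

context arratia
begin

lemma prob_unequal_le:
  assumes "u1 \<le> u2" "0 \<le> s" "s < t" "B \<in> sets (F s)" "\<And>\<omega>. \<omega> \<in> B \<Longrightarrow> y u2 s \<omega> - y u1 s \<omega> \<le> d"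
  shows "prob {\<omega> \<in> B. y u1 t \<omega> \<noteq> y u2 t \<omega>} \<le> prob B * (1 - 2 * std_normal_tail (d / sqrt (2 * (t - s))))"
proof -
  interpret arratia_pair M y u1 u2 by unfold_locales (rule assms(1))
  have eq: "y u1 v \<omega> = y u2 v \<omega> \<longleftrightarrow> gap v \<omega> = 0" for v \<omega>
    unfolding gap_def by linarith
  show ?thesis
    unfolding eq using assms by (intro prob_not_met_le) (simp_all add: gap_def)
qed

text \<open>Markov's inequality for the first absolute moment. This crude bound is enough because
  consecutive times \<open>exp (- k^2)\<close> have a ratio decaying exponentially in
  \<open>k\<close>.\<close>

lemma prob_gap_growth_le:
  assumes "u1 \<le> u2" "0 < t" "0 < a"
  shows "prob {\<omega> \<in> space M. u2 - u1 + a \<le> y u2 t \<omega> - y u1 t \<omega>} \<le> 2 * sqrt t / a"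
proof -
  interpret arratia_pair M y u1 u2 by unfold_locales (rule assms(1))
  have m: "integrable M (\<lambda>\<omega>. \<bar>gap t \<omega> - gap 0 \<omega>\<bar>)" "expectation (\<lambda>\<omega>. \<bar>gap t \<omega> - gap 0 \<omega>\<bar>) \<le> 2 * sqrt t"
    using gap_increment_moments(1,2)[of 0 t] assms by simp_all
  note [measurable] = measurable_gap[of t] measurable_gap[of 0]
  have "0 \<le> t" using assms by simp
  have "prob {\<omega> \<in> space M. u2 - u1 + a \<le> y u2 t \<omega> - y u1 t \<omega>} \<le> prob {\<omega> \<in> space M. a \<le> \<bar>gap t \<omega> - gap 0 \<omega>\<bar>}"
    using \<open>0 \<le> t\<close> by (intro finite_measure_mono) (auto simp: gap_0, auto simp: gap_def)
  also have "\<dots> \<le> expectation (\<lambda>\<omega>. \<bar>gap t \<omega> - gap 0 \<omega>\<bar>) / a"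
    using m(1) assms by (intro integral_Markov_inequality_measure[where A="{}"]) auto
  also have "\<dots> \<le> 2 * sqrt t / a" using m(2) assms by (intro divide_right_mono) auto
  finally show ?thesis .
qed

text \<open>Since the times \<open>\<tau> k\<close> decrease, the induction conditions on the indices above \<open>N\<close> first; the
  factors \<open>1 - 1 / k\<close> telescope.\<close>

lemma prob_no_merging_le:
  fixes \<tau> u d p :: "nat \<Rightarrow> real"
  assumes \<tau>: "\<And>k. 0 < \<tau> k" "\<And>k. \<tau> (Suc k) < \<tau> k" and u: "\<And>k. N \<le> k \<Longrightarrow> 0 \<le> u k"
    and N: "2 \<le> N"
    and tail: "\<And>k. N \<le> k \<Longrightarrow> 1 / k \<le> 2 * std_normal_tail (d k / sqrt (2 * (\<tau> k - \<tau> (Suc k))))"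
  shows "prob {\<omega> \<in> space M. \<forall>k\<in>{N..<N + j}. y (u k) (\<tau> (Suc k)) \<omega> - y 0 (\<tau> (Suc k)) \<omega> \<le> d k \<and>
      y 0 (\<tau> k) \<omega> \<noteq> y (u k) (\<tau> k) \<omega>} \<le> (real N - 1) / (real N + real j - 1)"
  using u N tail
proof (induction j arbitrary: N)
  case 0
  then show ?case by simp
next
  case (Suc j)
  define R where "R m i = {\<omega> \<in> space M. \<forall>k\<in>{m..<m + i}. y (u k) (\<tau> (Suc k)) \<omega> - y 0 (\<tau> (Suc k)) \<omega> \<le> d k \<and>
      y 0 (\<tau> k) \<omega> \<noteq> y (u k) (\<tau> k) \<omega>}" for m i
  define G where "G = {\<omega> \<in> space M. y (u N) (\<tau> (Suc N)) \<omega> - y 0 (\<tau> (Suc N)) \<omega> \<le> d N}"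
  define B where "B = R (Suc N) j \<inter> G"
  have anti: "\<tau> n \<le> \<tau> m" if "m \<le> n" for m n
    using less_imp_le[OF \<tau>(2)] that by (rule lift_Suc_antimono_le)
  \<comment> \<open>All indices above \<open>N\<close> involve only times up to
    \<open>\<tau> (Suc N)\<close>, so their joint event belongs to the past at that time.\<close>
  have adapt: "y v (\<tau> k) \<in> borel_measurable (F (\<tau> (Suc N)))" if "Suc N \<le> k" for v k
    by (rule adapted[OF less_imp_le[OF \<tau>(1)] anti[OF that]])
  have "R (Suc N) j \<in> sets (F (\<tau> (Suc N)))"
  proof -
    have "{\<omega> \<in> space (F (\<tau> (Suc N))). \<forall>k\<in>{Suc N..<Suc N + j}. y (u k) (\<tau> (Suc k)) \<omega> - y 0 (\<tau> (Suc k)) \<omega> \<le> d k \<and>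
      y 0 (\<tau> k) \<omega> \<noteq> y (u k) (\<tau> k) \<omega>} \<in> sets (F (\<tau> (Suc N)))"
    proof (rule sets.sets_Collect_finite_All)
      fix k assume k: "k \<in> {Suc N..<Suc N + j}"
      then have k': "Suc N \<le> k" "Suc N \<le> Suc k" by auto
      note [measurable] = adapt[OF k'(1)] adapt[OF k'(2)]
      show "{\<omega> \<in> space (F (\<tau> (Suc N))). y (u k) (\<tau> (Suc k)) \<omega> - y 0 (\<tau> (Suc k)) \<omega> \<le> d k \<and>
          y 0 (\<tau> k) \<omega> \<noteq> y (u k) (\<tau> k) \<omega>} \<in> sets (F (\<tau> (Suc N)))"
        by measurable
    qed simp
    then show ?thesis by (simp add: R_def)
  qed
  moreover have "G \<in> sets (F (\<tau> (Suc N)))"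
  proof -
    note [measurable] = adapt[of "Suc N", simplified]
    have "{\<omega> \<in> space (F (\<tau> (Suc N))). y (u N) (\<tau> (Suc N)) \<omega> - y 0 (\<tau> (Suc N)) \<omega> \<le> d N} \<in> sets (F (\<tau> (Suc N)))"
      by measurable
    then show ?thesis by (simp add: G_def)
  qed
  ultimately have BF: "B \<in> sets (F (\<tau> (Suc N)))" by (simp add: B_def)
  have "{N..<N + Suc j} = insert N {Suc N..<Suc N + j}" by auto
  then have RB: "R N (Suc j) = {\<omega> \<in> B. y 0 (\<tau> N) \<omega> \<noteq> y (u N) (\<tau> N) \<omega>}"
    by (auto simp: R_def B_def G_def)
  have IH: "prob (R (Suc N) j) \<le> (real (Suc N) - 1) / (real (Suc N) + real j - 1)"
    unfolding R_def using Suc.prems by (intro Suc.IH) auto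
  have RM: "R (Suc N) j \<in> sets M" by (rule sets_filtration_subset) fact
  have "prob (R N (Suc j)) \<le> prob B * (1 - 2 * std_normal_tail (d N / sqrt (2 * (\<tau> N - \<tau> (Suc N)))))"
    unfolding RB using \<tau>(2) Suc.prems(1)[of N] less_imp_le[OF \<tau>(1)]
    by (intro prob_unequal_le BF) (auto simp: B_def G_def)
  also have "\<dots> \<le> prob B * (1 - 1 / N)"
    using Suc.prems(3)[of N] by (intro mult_left_mono) auto
  also have "\<dots> \<le> ((real (Suc N) - 1) / (real (Suc N) + real j - 1)) * (1 - 1 / N)"
  proof (intro mult_right_mono)
    have "prob B \<le> prob (R (Suc N) j)"
      unfolding B_def using RM by (intro finite_measure_mono) auto
    then show "prob B \<le> (real (Suc N) - 1) / (real (Suc N) + real j - 1)" using IH by simp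
  qed (use Suc.prems(2) in simp)
  also have "\<dots> = (real N - 1) / (real N + real (Suc j) - 1)"
  proof -
    have "1 - 1 / real N = (real N - 1) / real N" using Suc.prems(2) by (simp add: diff_divide_distrib)
    moreover have "real (Suc N) - 1 = real N" "real (Suc N) + real j - 1 = real N + real j"
      "real N + real (Suc j) - 1 = real N + real j" by simp_all
    ultimately show ?thesis using Suc.prems(2) by simp
  qed
  finally show ?case unfolding R_def .
qed

text \<open>Almost surely the gap from 0 to \<open>u k\<close> exceeds \<open>d k\<close> at time
  \<open>\<tau> (Suc k)\<close> only finitely often, while the event that from some index on the gap
  is at most \<open>d k\<close> and the particles still fail to merge by \<open>\<tau> k\<close> has
  probability 0. Hence merging occurs infinitely often.\<close>

lemma cluster_lower:
  assumes rc: "right_continuous_version M y" and c: "0 < c" "c < 1"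
  shows "AE \<omega> in M. \<exists>\<^sub>F k in sequentially. ennreal (2 * c * sqrt (exp (- (real k)\<^sup>2) * ln k)) \<le> cluster_size y (exp (- (real k)\<^sup>2)) \<omega>"
proof -
  \<comment> \<open>The slack between \<open>c\<close> and \<open>b\<close> allows the gap to grow
    before \<open>\<tau> (Suc k)\<close>; the slack between \<open>b\<close> and 1 is what the tail
    estimate uses.\<close>
  define b where "b = (c + 1) / 2"
  have b: "0 < b" "b < 1" "c < b" using c by (auto simp: b_def)
  define \<tau> where "\<tau> k = exp (- (real k)\<^sup>2)" for k
  define u where "u k = 2 * c * sqrt (\<tau> k * ln k)" for k :: nat
  define d where "d k = 2 * b * sqrt (\<tau> k * ln k)" for k :: nat
  have \<tau>: "0 < \<tau> k" "\<tau> (Suc k) < \<tau> k" "\<tau> k \<le> 1" for k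
    by (auto simp: \<tau>_def intro!: power_strict_mono)
  have \<tau>_Suc: "\<tau> (Suc k) = \<tau> k * exp (- (2 * real k + 1))" for k
    by (simp add: \<tau>_def power2_eq_square algebra_simps flip: exp_add)
  have d_ratio: "d k / sqrt (2 * (\<tau> k - \<tau> (Suc k))) = b * sqrt (2 * ln k) / sqrt (1 - exp (- (2 * real k + 1)))" for k
  proof -
    have "\<tau> k - \<tau> (Suc k) = \<tau> k * (1 - exp (- (2 * real k + 1)))" by (simp add: \<tau>_Suc algebra_simps)
    then have "d k / sqrt (2 * (\<tau> k - \<tau> (Suc k))) =
        (sqrt (\<tau> k) * (2 * b * sqrt (ln k))) / (sqrt (\<tau> k) * (sqrt 2 * sqrt (1 - exp (- (2 * real k + 1)))))"
      by (simp only: d_def real_sqrt_mult mult_ac)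
    also have "\<dots> = 2 * b * sqrt (ln k) / (sqrt 2 * sqrt (1 - exp (- (2 * real k + 1))))"
      using \<tau>(1)[of k] by (intro mult_divide_mult_cancel_left) simp
    also have "\<dots> = (2 / sqrt 2) * (b * sqrt (ln k)) / sqrt (1 - exp (- (2 * real k + 1)))"
      by (simp add: mult_ac)
    also have "2 / sqrt 2 = sqrt (2::real)" by (rule real_div_sqrt) simp
    finally show ?thesis by (simp add: real_sqrt_mult mult_ac)
  qed
  obtain N0 where N0: "\<And>k. N0 \<le> k \<Longrightarrow> 1 / k \<le> 2 * std_normal_tail (d k / sqrt (2 * (\<tau> k - \<tau> (Suc k))))"
    using eventually_std_normal_tail_ge_inverse[OF b(1,2)] unfolding d_ratio eventually_sequentially by blast
  have u0: "0 \<le> u k" if "1 \<le> k" for k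
    using that c \<tau>(1)[of k] by (simp add: u_def)
  define H where "H k = {\<omega> \<in> space M. d k < y (u k) (\<tau> (Suc k)) \<omega> - y 0 (\<tau> (Suc k)) \<omega>}" for k
  define K where "K N = {\<omega> \<in> space M. \<forall>k\<ge>N. y (u k) (\<tau> (Suc k)) \<omega> - y 0 (\<tau> (Suc k)) \<omega> \<le> d k \<and>
      y 0 (\<tau> k) \<omega> \<noteq> y (u k) (\<tau> k) \<omega>}" for N
  have [measurable]: "y v (\<tau> k) \<in> borel_measurable M" for v k using \<tau>(1)[of k] by simp
  have [measurable]: "H k \<in> sets M" "K k \<in> sets M" for k unfolding H_def K_def by measurable
  have "prob (H k) \<le> exp (- 1) ^ k / (b - c)" if k: "3 \<le> k" for k
  proof -
    define r where "r = 2 * (b - c) * sqrt (\<tau> k * ln k)"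
    have "exp 1 \<le> real k" using exp_le k by linarith
    then have "1 \<le> ln (real k)" using k by (subst ln_ge_iff) auto
    then have r: "2 * (b - c) * sqrt (\<tau> k) \<le> r" using b \<tau>(1)[of k]
      unfolding r_def by (intro mult_left_mono real_sqrt_le_mono) auto
    moreover have "0 < 2 * (b - c) * sqrt (\<tau> k)" using b \<tau>(1)[of k] by simp
    ultimately have r0: "0 < r" by linarith
    have "prob (H k) \<le> prob {\<omega> \<in> space M. u k - 0 + r \<le> y (u k) (\<tau> (Suc k)) \<omega> - y 0 (\<tau> (Suc k)) \<omega>}"
      unfolding H_def by (intro finite_measure_mono) (auto simp: r_def u_def d_def algebra_simps)
    also have "\<dots> \<le> 2 * sqrt (\<tau> (Suc k)) / r"
      using u0[of k] k \<tau>(1) r0 by (intro prob_gap_growth_le) auto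
    also have "\<dots> \<le> 2 * sqrt (\<tau> (Suc k)) / (2 * (b - c) * sqrt (\<tau> k))"
      using r b \<tau>(1) r0 by (intro divide_left_mono) (auto intro: less_imp_le)
    also have "\<dots> = ((2 * sqrt (\<tau> k)) * sqrt (exp (- (2 * real k + 1)))) / ((2 * sqrt (\<tau> k)) * (b - c))"
      by (simp only: \<tau>_Suc real_sqrt_mult mult_ac)
    also have "\<dots> = sqrt (exp (- (2 * real k + 1))) / (b - c)"
      using \<tau>(1)[of k] by (intro mult_divide_mult_cancel_left) simp
    also have "\<dots> \<le> sqrt ((exp (- 1) ^ k)\<^sup>2) / (b - c)"
      using b by (intro divide_right_mono real_sqrt_le_mono) (auto simp flip: exp_of_nat_mult)
    finally show ?thesis by simp
  qed
  then have "eventually (\<lambda>k. norm (prob (H k)) \<le> exp (- 1) ^ k / (b - c)) sequentially"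
    unfolding eventually_sequentially by (intro exI[of _ 3]) simp
  moreover have "summable (\<lambda>k. exp (- 1 :: real) ^ k / (b - c))"
    by (intro summable_divide summable_geometric) simp
  ultimately have "summable (\<lambda>k. prob (H k))" by (rule summable_comparison_test_ev)
  then have "AE \<omega> in M. eventually (\<lambda>k. \<omega> \<in> space M - H k) sequentially"
    by (intro borel_cantelli_AE1) (auto simp: less_top[symmetric])
  moreover have "AE \<omega> in M. \<omega> \<notin> K N" if N: "max 2 N0 \<le> N" for N
  proof -
    \<comment> \<open>Each finite horizon \<open>j\<close> bounds \<open>K N\<close> from above, and
      the bound tends to 0 as \<open>j\<close> grows.\<close>
    have "prob (K N) \<le> (real N - 1) / (real N + real j - 1)" for j
    proof -
      have "prob (K N) \<le> prob {\<omega> \<in> space M. \<forall>k\<in>{N..<N + j}. y (u k) (\<tau> (Suc k)) \<omega> - y 0 (\<tau> (Suc k)) \<omega> \<le> d k \<and>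
          y 0 (\<tau> k) \<omega> \<noteq> y (u k) (\<tau> k) \<omega>}"
        unfolding K_def by (intro finite_measure_mono) auto
      also have "\<dots> \<le> (real N - 1) / (real N + real j - 1)"
        using N by (intro prob_no_merging_le \<tau> N0 u0) auto
      finally show ?thesis .
    qed
    moreover have "(\<lambda>j::nat. (real N - 1) / (real N + real j - 1)) \<longlonglongrightarrow> 0" by real_asymp
    ultimately have "prob (K N) \<le> 0"
      by (intro LIMSEQ_le_const[of _ 0]) auto
    then have "prob (K N) = 0" using measure_nonneg[of M "K N"] by simp
    then show ?thesis by (subst (asm) prob_eq_0) auto
  qed
  then have "AE \<omega> in M. \<forall>N\<in>{max 2 N0..}. \<omega> \<notin> K N"
    by (subst AE_ball_countable) auto
  ultimately show ?thesis
    using flow_mono_AE[OF rc] AE_space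
  proof eventually_elim
    case (elim \<omega>)
    obtain N1 where N1: "\<And>k. N1 \<le> k \<Longrightarrow> \<omega> \<notin> H k"
      using elim(1) by (auto simp: eventually_sequentially)
    have "\<exists>k\<ge>N. ennreal (u k) \<le> cluster_size y (\<tau> k) \<omega>" for N
    proof -
      define N' where "N' = max N (max N1 (max 2 N0))"
      have "N' \<in> {max 2 N0..}" by (auto simp: N'_def le_max_iff_disj)
      then have "\<omega> \<notin> K N'" using elim(2) by blast
      then obtain k where k: "N' \<le> k" "y (u k) (\<tau> (Suc k)) \<omega> - y 0 (\<tau> (Suc k)) \<omega> \<le> d k \<longrightarrow> y 0 (\<tau> k) \<omega> = y (u k) (\<tau> k) \<omega>"
        using elim(4) by (auto simp: K_def)
      have "\<omega> \<notin> H k" using k by (intro N1) (simp add: N'_def)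
      then have eq: "y 0 (\<tau> k) \<omega> = y (u k) (\<tau> k) \<omega>" using k elim(4) by (simp add: H_def not_less)
      have k1: "1 \<le> k" using k by (simp add: N'_def)
      have mono: "mono (\<lambda>v. y v (\<tau> k) \<omega>)" using elim(3) \<tau>(1,3)[of k] by (simp add: less_imp_le)
      \<comment> \<open>By monotonicity, merging of the two end particles sweeps up all particles
        between them.\<close>
      have "{0..u k} \<subseteq> {v. y 0 (\<tau> k) \<omega> = y v (\<tau> k) \<omega>}"
      proof
        fix v assume "v \<in> {0..u k}"
        then have "y 0 (\<tau> k) \<omega> \<le> y v (\<tau> k) \<omega>" "y v (\<tau> k) \<omega> \<le> y (u k) (\<tau> k) \<omega>"
          using monoD[OF mono] by auto
        then show "v \<in> {v. y 0 (\<tau> k) \<omega> = y v (\<tau> k) \<omega>}" using eq by simp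
      qed
      \<comment> \<open>Measurability matters here: \<open>emeasure\<close> is 0 on non-measurable
        sets, so a lower bound by inclusion needs the cluster itself to be measurable.\<close>
      moreover have "{v. y 0 (\<tau> k) \<omega> = y v (\<tau> k) \<omega>} \<in> sets lebesgue"
      proof -
        have "(\<lambda>v. y v (\<tau> k) \<omega>) \<in> borel_measurable borel" by (rule borel_measurable_mono[OF mono])
        then have "{v \<in> space borel. y 0 (\<tau> k) \<omega> = y v (\<tau> k) \<omega>} \<in> sets borel" by measurable
        then show ?thesis by simp
      qed
      ultimately have "emeasure lebesgue {0..u k} \<le> cluster_size y (\<tau> k) \<omega>"
        unfolding cluster_size_def by (rule emeasure_mono)
      then have "ennreal (u k) \<le> cluster_size y (\<tau> k) \<omega>" using u0[OF k1] by simp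
      moreover have "N \<le> k" using k by (simp add: N'_def)
      ultimately show ?thesis by blast
    qed
    then show ?case unfolding frequently_sequentially u_def \<tau>_def by blast
  qed
qed

end

section \<open>Passage to the upper limits\<close>

lemma ennreal_mult_divide_cancel: "0 \<le> a \<Longrightarrow> 0 < r \<Longrightarrow> ennreal (a * r) / ennreal r = ennreal a"
  by (simp add: divide_ennreal)

lemma Limsup_ge_of_frequently:
  fixes f :: "'b \<Rightarrow> 'c :: complete_lattice"
  assumes "\<exists>\<^sub>F x in G. a \<le> f x"
  shows "a \<le> Limsup G f"
proof (rule Limsup_greatest)
  fix P assume "eventually P G"
  then obtain x where "P x" "a \<le> f x"
    using frequently_eventually_conj[OF assms] by (auto dest!: frequently_ex)
  then show "a \<le> (SUP x\<in>Collect P. f x)" by (auto intro: SUP_upper2)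
qed

theorem theorem2:
  fixes M :: "'a measure" and y :: "real \<Rightarrow> real \<Rightarrow> 'a \<Rightarrow> real"
  assumes "arratia_flow M y"
    and "right_continuous_version M y"
  shows "AE \<omega> in M.
    Limsup (at_right 0) (\<lambda>t. cluster_size y t \<omega> / ennreal (sqrt (2 * t * ln (ln (1 / t))))) \<ge> 1 \<and>
    Limsup (at_right 0) (\<lambda>t. cluster_size y t \<omega> / ennreal (2 * sqrt (t * ln (ln (1 / t))))) \<le> 1"
proof -
  interpret prob_space M using assms(1) by (simp add: arratia_flow_def)
  interpret arratia M y by unfold_locales (rule assms(1))
  \<comment> \<open>The constants \<open>1 - 1 / (n + 2)\<close> and \<open>1 + 1 / (n + 1)\<close>
    approach 1 from below and above; a countable family of them shares one almost sure
    event.\<close>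
  have "AE \<omega> in M. \<forall>n::nat. \<exists>\<^sub>F k in sequentially.
      ennreal (2 * (1 - 1 / (real n + 2)) * sqrt (exp (- (real k)\<^sup>2) * ln k)) \<le> cluster_size y (exp (- (real k)\<^sup>2)) \<omega>"
    unfolding AE_all_countable by (intro allI cluster_lower assms(2)) auto
  moreover have "AE \<omega> in M. \<forall>n::nat. eventually (\<lambda>t. cluster_size y t \<omega> \<le>
      ennreal ((1 + 1 / (real n + 1)) * (2 * sqrt (t * ln (ln (1 / t)))))) (at_right 0)"
    unfolding AE_all_countable by (intro allI cluster_upper assms(2)) auto
  ultimately show ?thesis
  proof eventually_elim
    case (elim \<omega>)
    have "ennreal (1 - 1 / (real n + 2)) \<le> Limsup (at_right 0) (\<lambda>t. cluster_size y t \<omega> / ennreal (sqrt (2 * t * ln (ln (1 / t)))))" for n :: nat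
    proof (rule Limsup_ge_of_frequently)
      have lim: "filterlim (\<lambda>k. exp (- (real k)\<^sup>2)) (at_right 0) sequentially" by real_asymp
      have "\<exists>\<^sub>F k in sequentially. ennreal (1 - 1 / (real n + 2)) \<le>
        cluster_size y (exp (- (real k)\<^sup>2)) \<omega> / ennreal (sqrt (2 * exp (- (real k)\<^sup>2) * ln (ln (1 / exp (- (real k)\<^sup>2)))))"
      proof (rule frequently_rev_mp[OF elim(1)[rule_format, of n]])
        show "\<forall>\<^sub>F k in sequentially.
          ennreal (2 * (1 - 1 / (real n + 2)) * sqrt (exp (- (real k)\<^sup>2) * ln k)) \<le> cluster_size y (exp (- (real k)\<^sup>2)) \<omega> \<longrightarrow>
          ennreal (1 - 1 / (real n + 2)) \<le>
          cluster_size y (exp (- (real k)\<^sup>2)) \<omega> / ennreal (sqrt (2 * exp (- (real k)\<^sup>2) * ln (ln (1 / exp (- (real k)\<^sup>2)))))"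
          using eventually_gt_at_top[of 1]
        proof (eventually_elim, intro impI)
          fix k :: nat assume k: "1 < k"
          let ?S = "sqrt (exp (- (real k)\<^sup>2) * ln k)"
          assume le: "ennreal (2 * (1 - 1 / (real n + 2)) * ?S) \<le> cluster_size y (exp (- (real k)\<^sup>2)) \<omega>"
          have S: "0 < ?S" using k by simp
          \<comment> \<open>Along these times the iterated logarithm is \<open>2 * ln k\<close>, so
            the normaliser equals \<open>2 * ?S\<close>. This explains the factor 2 in the starting
            points of \<open>cluster_lower\<close>.\<close>
          have "ln (ln (1 / exp (- (real k)\<^sup>2))) = 2 * ln k"
          proof -
            have "1 / exp (- (real k)\<^sup>2) = exp ((real k)\<^sup>2)"
              by (simp add: exp_minus divide_inverse)
            then show ?thesis using k by (simp add: ln_realpow)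
          qed
          then have "sqrt (2 * exp (- (real k)\<^sup>2) * ln (ln (1 / exp (- (real k)\<^sup>2)))) = sqrt (2\<^sup>2 * (exp (- (real k)\<^sup>2) * ln k))"
            by (simp add: mult_ac)
          also have "\<dots> = 2 * ?S" by (simp only: real_sqrt_mult real_sqrt_abs abs_numeral)
          finally have eq: "sqrt (2 * exp (- (real k)\<^sup>2) * ln (ln (1 / exp (- (real k)\<^sup>2)))) = 2 * ?S" .
          have "ennreal (1 - 1 / (real n + 2)) = ennreal ((1 - 1 / (real n + 2)) * (2 * ?S)) / ennreal (2 * ?S)"
            using S by (intro ennreal_mult_divide_cancel[symmetric]) simp_all
          also have "\<dots> = ennreal (2 * (1 - 1 / (real n + 2)) * ?S) / ennreal (2 * ?S)"
            by (simp only: mult_ac)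
          also have "\<dots> \<le> cluster_size y (exp (- (real k)\<^sup>2)) \<omega> / ennreal (2 * ?S)"
            by (rule divide_right_mono_ennreal[OF le])
          finally show "ennreal (1 - 1 / (real n + 2)) \<le> cluster_size y (exp (- (real k)\<^sup>2)) \<omega> /
              ennreal (sqrt (2 * exp (- (real k)\<^sup>2) * ln (ln (1 / exp (- (real k)\<^sup>2)))))"
            unfolding eq .
        qed
      qed
      then show "\<exists>\<^sub>F t in at_right 0. ennreal (1 - 1 / (real n + 2)) \<le> cluster_size y t \<omega> / ennreal (sqrt (2 * t * ln (ln (1 / t))))"
        unfolding frequently_def using eventually_compose_filterlim[OF _ lim] by blast
    qed
    moreover have "(\<lambda>n::nat. ennreal (1 - 1 / (real n + 2))) \<longlonglongrightarrow> ennreal 1"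
      by (intro tendsto_ennrealI) real_asymp
    ultimately have "ennreal 1 \<le> Limsup (at_right 0) (\<lambda>t. cluster_size y t \<omega> / ennreal (sqrt (2 * t * ln (ln (1 / t)))))"
      by (intro LIMSEQ_le_const2[of "\<lambda>n::nat. ennreal (1 - 1 / (real n + 2))"]) auto
    moreover have "Limsup (at_right 0) (\<lambda>t. cluster_size y t \<omega> / ennreal (2 * sqrt (t * ln (ln (1 / t))))) \<le> ennreal (1 + 1 / (real n + 1))" for n :: nat
    proof (rule Limsup_bounded)
      \<comment> \<open>Near 0 the normaliser is positive, as needed to cancel it in the extended
        nonnegative reals.\<close>
      have "eventually (\<lambda>t::real. 0 < t * ln (ln (1 / t))) (at_right 0)" by real_asymp
      with elim(2)[rule_format, of n]
      show "\<forall>\<^sub>F t in at_right 0. cluster_size y t \<omega> / ennreal (2 * sqrt (t * ln (ln (1 / t)))) \<le> ennreal (1 + 1 / (real n + 1))"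
      proof eventually_elim
        case (elim t)
        let ?S = "sqrt (t * ln (ln (1 / t)))"
        have S: "0 < ?S" using elim(2) by simp
        have "cluster_size y t \<omega> / ennreal (2 * ?S) \<le> ennreal ((1 + 1 / (real n + 1)) * (2 * ?S)) / ennreal (2 * ?S)"
          by (rule divide_right_mono_ennreal[OF elim(1)])
        also have "\<dots> = ennreal (1 + 1 / (real n + 1))"
          using S by (intro ennreal_mult_divide_cancel) simp_all
        finally show ?case .
      qed
    qed
    moreover have "(\<lambda>n::nat. ennreal (1 + 1 / (real n + 1))) \<longlonglongrightarrow> ennreal 1"
      by (intro tendsto_ennrealI) real_asymp
    ultimately have "Limsup (at_right 0) (\<lambda>t. cluster_size y t \<omega> / ennreal (2 * sqrt (t * ln (ln (1 / t))))) \<le> ennreal 1"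
      by (intro LIMSEQ_le_const[of "\<lambda>n::nat. ennreal (1 + 1 / (real n + 1))"]) auto
    with \<open>ennreal 1 \<le> _\<close> show ?case by simp
  qed
qed

end
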